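(* Let $c=2\lambda>0$ and consider surfaces in $H_1$ without singular points with constant $p$-mean curvature $H=2\lambda$ and $\alpha$ not vanishing. In normal coordinates $(x,y)$, the functions $c_1(y)$ and $c_2(y)$ in the expression $$\alpha=\lambda\frac{\sin(2\lambda x+c_1(y))}{c_2(y)-\cos(2\lambda x+c_1(y))}$$ are unique in the following sense: up to a translation on $y$, $c_2(y)$ is unique up to a sign, and $c_1(y)$ is unique up to a constant. Denote these two unique functions by $\zeta_1(y)=c_1(y)$ and $\zeta_2(y)=c_2(y)$. Then $\{\zeta_1(y),\zeta_2(y)\}$ is a complete set of invariants for those surfaces.
   Context: The Heisenberg group $H_1$ is $\mathbb{R}^3$ with the group law $(x_1,y_1,z_1)\circ(x_2,y_2,z_2)=(x_1+x_2,\,y_1+y_2,\,z_1+z_2+y_1x_2-x_1y_2)$. Left invariant fields: $\mathring e_1=\partial_x+y\partial_z$, $\mathring e_2=\partial_y-x\partial_z$, $T=\partial_z$. Contact form $\Theta=dz+x\,dy-y\,dx$, contact bundle $\xi=\ker\Theta$, $J\mathring e_1=\mathring e_2$, $J\mathring e_2=-\mathring e_1$. The adapted metric makes $\mathring e_1,\mathring e_2,T$ orthonormal; $\nabla$ is the connection for which they are parallel. A Heisenberg rigid motion is a diffeomorphism of $H_1$ preserving $(J,\Theta)$. All objects are $C^\infty$. For a surface $\Sigma\subset H_1$ without singular points (points with $T_p\Sigma=\xi_p$) choose a unit field $e_1\in T\Sigma\cap\xi$, $e_2=Je_1$; the $p$-mean curvature $H$ is defined by $\nabla_{e_1}e_2=-He_1$.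 The $\alpha$-function is defined by $\alpha e_2+T\in T\Sigma$; $\hat e_1=e_1$, $\hat e_2=\frac{\alpha e_2+T}{\sqrt{1+\alpha^2}}$. Compatible coordinates $(x,y)$: $e_1=\partial_x$, $\hat e_2=a\,\partial_x+b\,\partial_y$ with $b>0$. In compatible coordinates the $\alpha$-function (not vanishing) of a surface with $H=2\lambda$ has the form displayed in the claim. Normal coordinates for such a surface are (local) compatible coordinates in which $$a=-\frac{\lambda}{(1+\alpha^2)^{1/2}},\qquad b=\frac{2\lambda^2}{|c_2-\cos(2\lambda x+c_1)|\,(1+\alpha^2)^{1/2}} .$$ "Complete set of invariants" means: these functions (modulo the stated ambiguity) are unchanged under Heisenberg rigid motions, and two such surfaces with the same invariants are locally congruent, i.e. differ by a Heisenberg rigid motion.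
   Formalization: Uniqueness is stated on each connected part of the overlap of two normal coordinate systems; equal invariants give local congruence at points with matching y and phase 2λx+c_1 (mod 2π, shifted by π if c_2 changes sign), since pieces over disjoint x-ranges need not be congruent. *)

theory Defs
  imports "HOL-Analysis.Analysis"
begin

primrec higher_differentiable_on ::
  "'a::real_normed_vector set \<Rightarrow> ('a \<Rightarrow> 'b::real_normed_vector) \<Rightarrow> nat \<Rightarrow> bool" where
  "higher_differentiable_on S f 0 \<longleftrightarrow> continuous_on S f"
| "higher_differentiable_on S f (Suc n) \<longleftrightarrow>
     (\<forall>x\<in>S. f differentiable (at x)) \<and>
     (\<forall>v. higher_differentiable_on S (\<lambda>x. frechet_derivative f (at x) v) n)"

text \<open>Meant for open subsets of finite-dimensional spaces, where this is the usual notion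
  of a function of class $C^\infty$.\<close>

definition smooth_on ::
  "'a::real_normed_vector set \<Rightarrow> ('a \<Rightarrow> 'b::real_normed_vector) \<Rightarrow> bool" where
  "smooth_on S f \<longleftrightarrow> (\<forall>n. higher_differentiable_on S f n)"


section \<open>The Heisenberg group\<close>

text \<open>Tangent vectors at a point are written in the standard basis of $\mathbb{R}^3$;
  vector fields are functions from points to such vectors.\<close>

type_synonym heis = "real \<times> real \<times> real"

definition frame1 :: "heis \<Rightarrow> heis" where
  "frame1 = (\<lambda>(x, y, z). (1, 0, y))"

definition frame2 :: "heis \<Rightarrow> heis" where
  "frame2 = (\<lambda>(x, y, z). (0, 1, - x))"

definition reeb :: "heis \<Rightarrow> heis" where
  "reeb = (\<lambda>p. (0, 0, 1))"

definition contact_form :: "heis \<Rightarrow> heis \<Rightarrow> real" where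
  "contact_form = (\<lambda>(x, y, z) (v1, v2, v3). v3 + x * v2 - y * v1)"

definition contact_plane :: "heis \<Rightarrow> heis set" where
  "contact_plane p = {v. contact_form p v = 0}"

text \<open>The coefficients of a tangent vector in the left invariant frame.\<close>

definition frame_coords :: "heis \<Rightarrow> heis \<Rightarrow> real \<times> real \<times> real" where
  "frame_coords p v = (fst v, fst (snd v), contact_form p v)"

lemma frame_coords_iff:
  "frame_coords p v = (a, b, c) \<longleftrightarrow>
     v = a *\<^sub>R frame1 p + b *\<^sub>R frame2 p + c *\<^sub>R reeb p"
  by (cases p; cases v)
    (auto simp: frame_coords_def frame1_def frame2_def reeb_def contact_form_def algebra_simps)

text \<open>Only the values on the contact plane matter; off it, J is extended by zero on the Reeb field.\<close>

definition J :: "heis \<Rightarrow> heis \<Rightarrow> heis" where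
  "J p v = fst v *\<^sub>R frame2 p - fst (snd v) *\<^sub>R frame1 p"

definition adapted_metric :: "heis \<Rightarrow> heis \<Rightarrow> heis \<Rightarrow> real" where
  "adapted_metric p u v = inner (frame_coords p u) (frame_coords p v)"

definition heis_rigid_motion :: "(heis \<Rightarrow> heis) \<Rightarrow> bool" where
  "heis_rigid_motion F \<longleftrightarrow>
     bij F \<and> smooth_on UNIV F \<and> smooth_on UNIV (inv F) \<and>
     (\<forall>p v. contact_form (F p) (frechet_derivative F (at p) v) = contact_form p v) \<and>
     (\<forall>p. \<forall>v\<in>contact_plane p.
        J (F p) (frechet_derivative F (at p) v) = frechet_derivative F (at p) (J p v))"

definition push_forward :: "(heis \<Rightarrow> heis) \<Rightarrow> (heis \<Rightarrow> heis) \<Rightarrow> heis \<Rightarrow> heis" where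
  "push_forward F V q = frechet_derivative F (at (inv F q)) (V (inv F q))"


section \<open>Surfaces\<close>

definition local_param :: "heis set \<Rightarrow> (real \<times> real) set \<Rightarrow> (real \<times> real \<Rightarrow> heis) \<Rightarrow> bool" where
  "local_param S U X \<longleftrightarrow>
     open U \<and> smooth_on U X \<and>
     (\<forall>u\<in>U. inj (frechet_derivative X (at u))) \<and>
     openin (top_of_set S) (X ` U) \<and>
     (\<exists>g. homeomorphism U (X ` U) X g)"

definition smooth_surface :: "heis set \<Rightarrow> bool" where
  "smooth_surface S \<longleftrightarrow> (\<forall>p\<in>S. \<exists>U X. local_param S U X \<and> p \<in> X ` U)"

definition curve_in :: "heis set \<Rightarrow> heis \<Rightarrow> heis \<Rightarrow> (real \<Rightarrow> heis) \<Rightarrow> bool" where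
  "curve_in S p v \<gamma> \<longleftrightarrow>
     (\<exists>r>0. smooth_on {-r<..<r} \<gamma> \<and> \<gamma> ` {-r<..<r} \<subseteq> S) \<and>
     \<gamma> 0 = p \<and> (\<gamma> has_vector_derivative v) (at 0)"

definition tangent_space :: "heis set \<Rightarrow> heis \<Rightarrow> heis set" where
  "tangent_space S p = {v. \<exists>\<gamma>. curve_in S p v \<gamma>}"

definition smooth_field_along :: "heis set \<Rightarrow> (heis \<Rightarrow> heis) \<Rightarrow> bool" where
  "smooth_field_along S V \<longleftrightarrow> (\<forall>U X. local_param S U X \<longrightarrow> smooth_on U (V \<circ> X))"

text \<open>\<open>has_nabla S V p v w\<close>: the covariant derivative at p, in the direction v tangent to S,
  of the field V along S is w. As the left invariant frame is parallel, the connection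
  differentiates the coefficients of V in that frame.\<close>

definition has_nabla :: "heis set \<Rightarrow> (heis \<Rightarrow> heis) \<Rightarrow> heis \<Rightarrow> heis \<Rightarrow> heis \<Rightarrow> bool" where
  "has_nabla S V p v w \<longleftrightarrow>
     v \<in> tangent_space S p \<and>
     (\<forall>\<gamma>. curve_in S p v \<gamma> \<longrightarrow>
        ((\<lambda>t. frame_coords (\<gamma> t) (V (\<gamma> t))) has_vector_derivative frame_coords p w) (at 0))"

text \<open>A surface without singular points, with a choice E of the unit field $e_1$
  (determined by the surface only up to sign).\<close>

definition nonsingular_surface :: "heis set \<Rightarrow> (heis \<Rightarrow> heis) \<Rightarrow> bool" where
  "nonsingular_surface S E \<longleftrightarrow>
     smooth_surface S \<and>
     (\<forall>p\<in>S. tangent_space S p \<noteq> contact_plane p) \<and>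
     smooth_field_along S E \<and>
     (\<forall>p\<in>S. E p \<in> tangent_space S p \<inter> contact_plane p \<and> adapted_metric p (E p) (E p) = 1)"

abbreviation e2_field :: "(heis \<Rightarrow> heis) \<Rightarrow> heis \<Rightarrow> heis" where
  "e2_field E \<equiv> (\<lambda>p. J p (E p))"

definition has_p_mean_curvature :: "heis set \<Rightarrow> (heis \<Rightarrow> heis) \<Rightarrow> heis \<Rightarrow> real \<Rightarrow> bool" where
  "has_p_mean_curvature S E p h \<longleftrightarrow> has_nabla S (e2_field E) p (E p) (- h *\<^sub>R E p)"

definition alpha :: "heis set \<Rightarrow> (heis \<Rightarrow> heis) \<Rightarrow> heis \<Rightarrow> real" where
  "alpha S E p = (THE a. a *\<^sub>R e2_field E p + reeb p \<in> tangent_space S p)"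

definition e2_hat :: "heis set \<Rightarrow> (heis \<Rightarrow> heis) \<Rightarrow> heis \<Rightarrow> heis" where
  "e2_hat S E p =
     (1 / sqrt (1 + (alpha S E p)\<^sup>2)) *\<^sub>R (alpha S E p *\<^sub>R e2_field E p + reeb p)"

text \<open>The class of surfaces under consideration: $H = 2\lambda$ and \<open>alpha\<close> vanishes nowhere.\<close>

definition cpmc_surface :: "real \<Rightarrow> heis set \<Rightarrow> (heis \<Rightarrow> heis) \<Rightarrow> bool" where
  "cpmc_surface l S E \<longleftrightarrow>
     nonsingular_surface S E \<and>
     (\<forall>p\<in>S. has_p_mean_curvature S E p (2 * l)) \<and>
     (\<forall>p\<in>S. alpha S E p \<noteq> 0)"


section \<open>Compatible and normal coordinates\<close>

text \<open>Coordinates are given by their inverse, a local parametrization X defined on U.\<close>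

definition compatible_coords ::
  "heis set \<Rightarrow> (heis \<Rightarrow> heis) \<Rightarrow> (real \<times> real) set \<Rightarrow> (real \<times> real \<Rightarrow> heis) \<Rightarrow>
   (real \<times> real \<Rightarrow> real) \<Rightarrow> (real \<times> real \<Rightarrow> real) \<Rightarrow> bool" where
  "compatible_coords S E U X a b \<longleftrightarrow>
     local_param S U X \<and>
     (\<forall>u\<in>U.
        E (X u) = frechet_derivative X (at u) (1, 0) \<and>
        e2_hat S E (X u) =
          a u *\<^sub>R frechet_derivative X (at u) (1, 0) + b u *\<^sub>R frechet_derivative X (at u) (0, 1) \<and>
        b u > 0)"

definition normal_coords ::
  "real \<Rightarrow> heis set \<Rightarrow> (heis \<Rightarrow> heis) \<Rightarrow> (real \<times> real) set \<Rightarrow> (real \<times> real \<Rightarrow> heis) \<Rightarrow>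
   (real \<Rightarrow> real) \<Rightarrow> (real \<Rightarrow> real) \<Rightarrow> bool" where
  "normal_coords l S E U X c1 c2 \<longleftrightarrow>
     smooth_on (snd ` U) c1 \<and> smooth_on (snd ` U) c2 \<and>
     (\<forall>(x, y)\<in>U.
        c2 y - cos (2 * l * x + c1 y) \<noteq> 0 \<and>
        alpha S E (X (x, y)) =
          l * (sin (2 * l * x + c1 y) / (c2 y - cos (2 * l * x + c1 y)))) \<and>
     compatible_coords S E U X
       (\<lambda>(x, y). - l / sqrt (1 + (alpha S E (X (x, y)))\<^sup>2))
       (\<lambda>(x, y). 2 * l\<^sup>2 /
          (\<bar>c2 y - cos (2 * l * x + c1 y)\<bar> * sqrt (1 + (alpha S E (X (x, y)))\<^sup>2)))"

text \<open>Equality of the pairs (c1, c2) on Y and (c1', c2') on Y' up to the translation by t on y,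
  the sign s of c2 and the constant d added to c1. The functions are compared where both are
  defined.\<close>

definition agree_up_to ::
  "real \<Rightarrow> real \<Rightarrow> real \<Rightarrow> real set \<Rightarrow> (real \<Rightarrow> real) \<Rightarrow> (real \<Rightarrow> real) \<Rightarrow>
   real set \<Rightarrow> (real \<Rightarrow> real) \<Rightarrow> (real \<Rightarrow> real) \<Rightarrow> bool" where
  "agree_up_to t s d Y c1 c2 Y' c1' c2' \<longleftrightarrow>
     s \<in> {1, -1} \<and>
     (\<forall>y\<in>Y. y + t \<in> Y' \<longrightarrow> c2' (y + t) = s * c2 y \<and> c1' (y + t) = c1 y + d)"

text \<open>Local congruence of S near p with S' near p'.\<close>

definition locally_congruent_at :: "heis set \<Rightarrow> heis \<Rightarrow> heis set \<Rightarrow> heis \<Rightarrow> bool" where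
  "locally_congruent_at S p S' p' \<longleftrightarrow>
     (\<exists>F V. heis_rigid_motion F \<and> F p = p' \<and> open V \<and> p \<in> V \<and> F ` (S \<inter> V) = S' \<inter> F ` V)"

text \<open>Changing normal coordinates may translate x, which changes c1 by a constant; the constant
  in \<open>agree_up_to\<close> therefore does not by itself say which points of two coordinate domains
  correspond. The corresponding points are those with the same position in the period of
  \<open>alpha\<close>: the phase $2\lambda x + c_1(y)$ agrees modulo $2\pi$, up to the shift by $\pi$ that
  goes with the change of sign of c2. Without this the coordinate ranges in x of
  two surfaces with equal c1 and c2 could be disjoint.\<close>

definition phases_match ::
  "real \<Rightarrow> real \<Rightarrow> (real \<Rightarrow> real) \<Rightarrow> (real \<Rightarrow> real) \<Rightarrow> real \<times> real \<Rightarrow> real \<times> real \<Rightarrow> bool" where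
  "phases_match l s c1 c1' u u' \<longleftrightarrow>
     cis (2 * l * fst u' + c1' (snd u')) = of_real s * cis (2 * l * fst u + c1 (snd u))"

end

theory Submission
  imports Defs
begin

text \<open>Since the contact form and J are preserved, a rigid motion is a rotation about the z-axis
  followed by a left translation, and invariance is a computation with affine maps. In normal
  coordinates write $X_x = P\,\mathring e_1 + Q\,\mathring e_2$ and
  $D = c_2 - \cos\varphi$ with $\varphi = 2\lambda x + c_1$. The curvature condition and
  the equality of mixed derivatives say that the angle of $(P, Q)$ has the differential
  $2\lambda\,dx + \mathrm{sgn}(D)\,c_2\,dy$, and in the left invariant frame $X_y$ is a
  function of $P$, $Q$, $D$ and $\varphi$. So $c_1$ and $c_2$ determine $X$ up to a rotation and
  a left translation.
  Conversely, a change of normal coordinates preserves $e_1$, because the opposite choice changes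
  the sign of $H$, and differentiating the equation for \<open>alpha\<close> along $e_1$ gives
  $D' = \pm D$ and $\cos\varphi' = \pm\cos\varphi$ with the same sign. Hence the
  differential of the change of coordinates is the identity.\<close>

section \<open>Smooth maps\<close>

text \<open>The prescribed a and b turn the expansion of the second unit tangent into X_y = |D| N /
  (2 lambda^2) with N = alpha e_2 + T + lambda e_1. As alpha = lambda sin(phi) / D, the denominator
  cancels and X_y becomes sgn(D) times a polynomial expression in P, Q, D and sin(phi). This is the
  origin of the sign ambiguity: a shift of phi by pi changes the signs of D, sin(phi) and c_2
  together, and they enter only through sgn(D) D, sgn(D) sin(phi) and sgn(D) c_2. The additive
  constant in c_1 compensates a translation of x. Two obstacles shape the proof. A parametrization
  comes with an inverse that is only known to be continuous, so the differentiability of a change of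
  coordinates has to be derived from the injectivity of the derivative. And the contact form depends
  on the base point, so two maps with equal frame coefficients are first identified in their first
  two components and only then in the third. Domains need not be connected: congruence is proved on
  a ball, uniqueness over a connected piece of the overlap.\<close>

lemma higher_differentiable_on_cong:
  assumes "open S" "\<And>x. x \<in> S \<Longrightarrow> f x = g x"
  shows "higher_differentiable_on S f n \<longleftrightarrow> higher_differentiable_on S g n"
  using assms(2)
proof (induction n arbitrary: f g)
  case 0
  then show ?case by (auto cong: continuous_on_cong)
next
  case (Suc n)
  have diff: "f differentiable (at x) \<longleftrightarrow> g differentiable (at x)" if "x \<in> S" for x
    using Suc.prems has_derivative_transform_within_open[OF _ \<open>open S\<close> that, of f _ UNIV g]
      has_derivative_transform_within_open[OF _ \<open>open S\<close> that, of g _ UNIV f]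
    unfolding differentiable_def by metis
  have "higher_differentiable_on S (\<lambda>x. frechet_derivative f (at x) v) n \<longleftrightarrow>
        higher_differentiable_on S (\<lambda>x. frechet_derivative g (at x) v) n"
    if "\<forall>x\<in>S. f differentiable (at x)" for v
    by (rule Suc.IH)
      (use that Suc.prems frechet_derivative_transform_within_open[OF _ \<open>open S\<close>] in force)
  then show ?case
    using diff by auto
qed

lemma smooth_on_has_derivative:
  assumes "smooth_on S f" "x \<in> S"
  shows "(f has_derivative frechet_derivative f (at x)) (at x)"
proof -
  have "higher_differentiable_on S f (Suc 0)"
    using assms(1) unfolding smooth_on_def by blast
  then show ?thesis
    using assms(2) frechet_derivative_works by auto
qed

lemma frechet_derivative_eqI: "(f has_derivative D) (at x) \<Longrightarrow> frechet_derivative f (at x) = D"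
  by (metis frechet_derivative_at)

lemma smooth_on_frechet_derivative:
  assumes "smooth_on S f"
  shows "smooth_on S (\<lambda>x. frechet_derivative f (at x) v)"
  unfolding smooth_on_def
proof
  fix n
  have "higher_differentiable_on S f (Suc n)"
    using assms unfolding smooth_on_def by blast
  then show "higher_differentiable_on S (\<lambda>x. frechet_derivative f (at x) v) n" by simp
qed

lemma smooth_on_imp_continuous_on: "smooth_on S f \<Longrightarrow> continuous_on S f"
  unfolding smooth_on_def by (metis higher_differentiable_on.simps(1))

lemma higher_differentiable_on_const: "higher_differentiable_on S (\<lambda>x. c) n"
  by (induction n arbitrary: c) auto

text \<open>Serves postcomposition with coordinate projections and with rigid motions, which turn
  out to be affine. Differentiating replaces \<open>f\<close> by a directional derivative and
  \<open>c\<close> by 0, so both vary in the induction.\<close>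

lemma higher_differentiable_on_affine:
  assumes "open S" "bounded_linear L" "higher_differentiable_on S f n"
  shows "higher_differentiable_on S (\<lambda>x. c + L (f x)) n"
  using assms(3)
proof (induction n arbitrary: f c)
  case 0
  then show ?case
    using continuous_on_compose2[OF linear_continuous_on[OF assms(2), of UNIV], of S f]
    by (auto intro!: continuous_intros)
next
  case (Suc n)
  have D: "((\<lambda>x. c + L (f x)) has_derivative (\<lambda>v. L (frechet_derivative f (at x) v))) (at x)"
    if "x \<in> S" for x
  proof -
    have "(f has_derivative frechet_derivative f (at x)) (at x)"
      using Suc.prems that frechet_derivative_works by auto
    from bounded_linear.has_derivative[OF assms(2) this]
    show ?thesis
      using has_derivative_add[OF has_derivative_const, of _ _ _ c] by fastforce
  qed
  have "higher_differentiable_on S (\<lambda>x. frechet_derivative (\<lambda>x. c + L (f x)) (at x) v) n" for v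
  proof -
    have "higher_differentiable_on S (\<lambda>x. L (frechet_derivative f (at x) v)) n"
      using Suc.IH[of "\<lambda>x. frechet_derivative f (at x) v" 0] Suc.prems by simp
    then show ?thesis
      using frechet_derivative_at[OF D]
      by (subst higher_differentiable_on_cong[OF \<open>open S\<close>]) (auto simp: fun_eq_iff)
  qed
  then show ?case
    using D by (auto simp: differentiable_def)
qed

lemma smooth_on_affine:
  "open S \<Longrightarrow> bounded_linear L \<Longrightarrow> smooth_on S f \<Longrightarrow> smooth_on S (\<lambda>x. c + L (f x))"
  by (simp add: smooth_on_def higher_differentiable_on_affine)

lemma smooth_on_linear:
  "open S \<Longrightarrow> bounded_linear L \<Longrightarrow> smooth_on S f \<Longrightarrow> smooth_on S (\<lambda>x. L (f x))"
  using smooth_on_affine[of S L f 0] by simp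

text \<open>Makes the image of a straight line under a parametrization a smooth curve. The
  derivative in direction \<open>v\<close> is that of \<open>f\<close> in direction
  \<open>L v\<close>, precomposed with the same affine map, so only \<open>f\<close> varies in the
  induction.\<close>

lemma higher_differentiable_on_compose_affine:
  assumes "open I" "bounded_linear L" "\<And>t. t \<in> I \<Longrightarrow> c + L t \<in> S"
    and "higher_differentiable_on S f n"
  shows "higher_differentiable_on I (\<lambda>t. f (c + L t)) n"
  using assms(4)
proof (induction n arbitrary: f)
  case 0
  have "continuous_on I (\<lambda>t. c + L t)"
    by (intro continuous_intros linear_continuous_on assms)
  then show ?case
    using 0 assms(3) by (auto intro: continuous_on_compose2)
next
  case (Suc n)
  have D: "((\<lambda>t. f (c + L t)) has_derivative (\<lambda>v. frechet_derivative f (at (c + L t)) (L v))) (at t)"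
    if "t \<in> I" for t
  proof -
    have 1: "(f has_derivative frechet_derivative f (at (c + L t))) (at (c + L t))"
      using Suc.prems assms(3)[OF that] frechet_derivative_works by auto
    have "((\<lambda>t. c + L t) has_derivative (\<lambda>v. 0 + L v)) (at t)"
      by (intro has_derivative_add has_derivative_const
          bounded_linear.has_derivative[OF assms(2) has_derivative_ident])
    from has_derivative_compose[OF this 1] show ?thesis by simp
  qed
  have "higher_differentiable_on I (\<lambda>t. frechet_derivative (\<lambda>t. f (c + L t)) (at t) v) n" for v
  proof -
    have "higher_differentiable_on I (\<lambda>t. frechet_derivative f (at (c + L t)) (L v)) n"
      using Suc by auto
    then show ?thesis
      using frechet_derivative_at[OF D]
      by (subst higher_differentiable_on_cong[OF \<open>open I\<close>]) (auto simp: fun_eq_iff)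
  qed
  then show ?case
    using D by (auto simp: differentiable_def)
qed

lemma smooth_on_compose_affine:
  "\<lbrakk>open I; bounded_linear L; \<And>t. t \<in> I \<Longrightarrow> c + L t \<in> S; smooth_on S f\<rbrakk>
    \<Longrightarrow> smooth_on I (\<lambda>t. f (c + L t))"
  unfolding smooth_on_def by (blast intro: higher_differentiable_on_compose_affine)

section \<open>Symmetry of mixed second derivatives\<close>

lemma has_derivative_along_line:
  fixes f :: "'a::real_normed_vector \<Rightarrow> 'b::real_normed_vector"
  assumes "(f has_derivative f') (at (x + t *\<^sub>R v))"
  shows "((\<lambda>s. f (x + s *\<^sub>R v)) has_vector_derivative f' v) (at t within T)"
proof -
  have "((\<lambda>s. x + s *\<^sub>R v) has_derivative (\<lambda>h. h *\<^sub>R v)) (at t within T)"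
    by (auto intro!: derivative_eq_intros)
  from has_derivative_compose[OF this assms]
  show ?thesis
    using assms has_derivative_linear[OF assms]
    by (simp add: has_vector_derivative_def linear_cmul)
qed

text \<open>The second difference is symmetric in \<open>v\<close> and \<open>w\<close>, which will
  force the mixed derivatives to agree. The mean value theorem is applied twice: in direction
  \<open>v\<close> to the difference of \<open>f\<close> along two parallel segments, then in
  direction \<open>w\<close> to the derivative so obtained.\<close>

lemma second_difference_mvt:
  fixes f :: "'a::real_normed_vector \<Rightarrow> real"
  assumes sm: "smooth_on S f" and "t > 0"
    and S: "\<And>a b. 0 \<le> a \<Longrightarrow> a \<le> t \<Longrightarrow> 0 \<le> b \<Longrightarrow> b \<le> t \<Longrightarrow> x + a *\<^sub>R v + b *\<^sub>R w \<in> S"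
  obtains a b where "0 \<le> a" "a \<le> t" "0 \<le> b" "b \<le> t"
    "f (x + t *\<^sub>R v + t *\<^sub>R w) - f (x + t *\<^sub>R v) - f (x + t *\<^sub>R w) + f x =
      t\<^sup>2 * frechet_derivative (\<lambda>y. frechet_derivative f (at y) v) (at (x + a *\<^sub>R v + b *\<^sub>R w)) w"
proof -
  let ?g = "\<lambda>y. frechet_derivative f (at y) v"
  let ?p = "\<lambda>s. f ((x + t *\<^sub>R w) + s *\<^sub>R v) - f (x + s *\<^sub>R v)"
  have g: "smooth_on S ?g"
    by (rule smooth_on_frechet_derivative[OF sm])
  have d: "(?p has_vector_derivative ?g ((x + t *\<^sub>R w) + s *\<^sub>R v) - ?g (x + s *\<^sub>R v))
      (at s within {0..t})"
    if "0 \<le> s" "s \<le> t" for s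
  proof -
    have "x + t *\<^sub>R w + s *\<^sub>R v \<in> S" "x + s *\<^sub>R v \<in> S"
      using S[of s t] S[of s 0] that \<open>t > 0\<close> by (simp_all add: ac_simps)
    then show ?thesis
      by (intro has_vector_derivative_diff has_derivative_along_line smooth_on_has_derivative[OF sm])
  qed
  have "\<exists>a\<in>{0..t}. ?p t - ?p 0 = (\<lambda>h. h *\<^sub>R (?g ((x + t *\<^sub>R w) + a *\<^sub>R v) - ?g (x + a *\<^sub>R v))) (t - 0)"
    by (rule mvt_very_simple)
      (use \<open>t > 0\<close> d in \<open>auto simp: has_vector_derivative_def\<close>)
  then obtain a where a: "0 \<le> a" "a \<le> t"
    and pa: "?p t - ?p 0 = t * (?g ((x + t *\<^sub>R w) + a *\<^sub>R v) - ?g (x + a *\<^sub>R v))"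
    by auto
  let ?q = "\<lambda>s. ?g ((x + a *\<^sub>R v) + s *\<^sub>R w)"
  have "(?q has_vector_derivative frechet_derivative ?g (at (x + a *\<^sub>R v + s *\<^sub>R w)) w)
      (at s within {0..t})" if "0 \<le> s" "s \<le> t" for s
    by (intro has_derivative_along_line smooth_on_has_derivative[OF g] S a that)
  then have "\<exists>b\<in>{0..t}. ?q t - ?q 0 =
      (\<lambda>h. h *\<^sub>R frechet_derivative ?g (at (x + a *\<^sub>R v + b *\<^sub>R w)) w) (t - 0)"
    by (intro mvt_very_simple) (use \<open>t > 0\<close> in \<open>auto simp: has_vector_derivative_def\<close>)
  then obtain b where b: "0 \<le> b" "b \<le> t"
    and qb: "?q t - ?q 0 = t * frechet_derivative ?g (at (x + a *\<^sub>R v + b *\<^sub>R w)) w"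
    by auto
  have "f (x + t *\<^sub>R v + t *\<^sub>R w) - f (x + t *\<^sub>R v) - f (x + t *\<^sub>R w) + f x = ?p t - ?p 0"
    by (simp add: ac_simps)
  also have "\<dots> = t * (?q t - ?q 0)"
    unfolding pa by (simp add: ac_simps)
  also have "\<dots> = t\<^sup>2 * frechet_derivative ?g (at (x + a *\<^sub>R v + b *\<^sub>R w)) w"
    unfolding qb by (simp add: power2_eq_square)
  finally show thesis
    using that a b by blast
qed

lemma symmetric_second_derivative:
  fixes f :: "'a::real_normed_vector \<Rightarrow> real"
  assumes sm: "smooth_on S f" and "open S" "x \<in> S"
  shows "frechet_derivative (\<lambda>y. frechet_derivative f (at y) v) (at x) w =
         frechet_derivative (\<lambda>y. frechet_derivative f (at y) w) (at x) v"
proof (rule ccontr)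
  let ?h = "\<lambda>v w y. frechet_derivative (\<lambda>y. frechet_derivative f (at y) v) (at y) w"
  \<comment> \<open>Half of the gap: two values within \<open>e\<close> of a common number are
    closer to each other than the gap.\<close>
  define e where "e = \<bar>?h v w x - ?h w v x\<bar> / 2"
  assume "\<not> ?thesis"
  then have "e > 0"
    by (simp add: e_def)
  have "isCont (?h v w) x" for v w
    using continuous_on_eq_continuous_at[OF \<open>open S\<close>] smooth_on_imp_continuous_on[OF
        smooth_on_frechet_derivative[OF smooth_on_frechet_derivative[OF sm]]] \<open>x \<in> S\<close> by fast
  then have "\<exists>d>0. \<forall>y. dist y x < d \<longrightarrow> \<bar>?h v w y - ?h v w x\<bar> < e" for v w
    using \<open>e > 0\<close> unfolding continuous_at_eps_delta dist_real_def by blast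
  then obtain d1 d2 where d: "d1 > 0" "\<And>y. dist y x < d1 \<Longrightarrow> \<bar>?h v w y - ?h v w x\<bar> < e"
      "d2 > 0" "\<And>y. dist y x < d2 \<Longrightarrow> \<bar>?h w v y - ?h w v x\<bar> < e"
    by metis
  obtain d3 where d3: "d3 > 0" "ball x d3 \<subseteq> S"
    using \<open>open S\<close> \<open>x \<in> S\<close> openE by blast
  define r where "r = min d1 (min d2 d3)"
  \<comment> \<open>Small enough for the parallelogram spanned by \<open>t v\<close> and
    \<open>t w\<close> to stay in the ball of radius \<open>r\<close>; the summand 1 keeps the
    denominator positive.\<close>
  define t where "t = r / (norm v + norm w + 1)"
  have "r > 0" "t > 0"
    using d d3 by (auto simp: r_def t_def add_nonneg_pos)
  have near: "dist (x + a *\<^sub>R v + b *\<^sub>R w) x < r" if "0 \<le> a" "a \<le> t" "0 \<le> b" "b \<le> t" for a b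
  proof -
    have "dist (x + a *\<^sub>R v + b *\<^sub>R w) x \<le> norm (a *\<^sub>R v) + norm (b *\<^sub>R w)"
      by (simp add: dist_norm add.assoc del: norm_scaleR) (rule norm_triangle_ineq)
    also have "\<dots> \<le> t * norm v + t * norm w"
      using that by (intro add_mono) (auto intro: mult_right_mono)
    also have "\<dots> < t * (norm v + norm w + 1)"
      using \<open>t > 0\<close> by (simp add: algebra_simps)
    also have "\<dots> = r"
      using add_nonneg_pos[OF add_nonneg_nonneg[OF norm_ge_zero[of v] norm_ge_zero[of w]] zero_less_one]
      by (simp add: t_def)
    finally show ?thesis .
  qed
  have near': "dist (x + a *\<^sub>R w + b *\<^sub>R v) x < r" if "0 \<le> a" "a \<le> t" "0 \<le> b" "b \<le> t" for a b
    using near[of b a] that by (simp add: ac_simps)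
  have S: "y \<in> S" if "dist y x < r" for y
    using that d3 by (auto simp: r_def dist_commute)
  obtain a b where ab: "0 \<le> a" "a \<le> t" "0 \<le> b" "b \<le> t"
    "f (x + t *\<^sub>R v + t *\<^sub>R w) - f (x + t *\<^sub>R v) - f (x + t *\<^sub>R w) + f x =
      t\<^sup>2 * ?h v w (x + a *\<^sub>R v + b *\<^sub>R w)"
    using second_difference_mvt[OF sm \<open>t > 0\<close>, of x v w] S near by blast
  obtain a' b' where ab': "0 \<le> a'" "a' \<le> t" "0 \<le> b'" "b' \<le> t"
    "f (x + t *\<^sub>R w + t *\<^sub>R v) - f (x + t *\<^sub>R w) - f (x + t *\<^sub>R v) + f x =
      t\<^sup>2 * ?h w v (x + a' *\<^sub>R w + b' *\<^sub>R v)"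
    using second_difference_mvt[OF sm \<open>t > 0\<close>, of x w v] S near' by blast
  have "t\<^sup>2 * ?h v w (x + a *\<^sub>R v + b *\<^sub>R w) = t\<^sup>2 * ?h w v (x + a' *\<^sub>R w + b' *\<^sub>R v)"
    unfolding ab(5)[symmetric] ab'(5)[symmetric] by (simp add: ac_simps)
  then have "?h v w (x + a *\<^sub>R v + b *\<^sub>R w) = ?h w v (x + a' *\<^sub>R w + b' *\<^sub>R v)"
    using \<open>t > 0\<close> by simp
  moreover have "\<bar>?h v w (x + a *\<^sub>R v + b *\<^sub>R w) - ?h v w x\<bar> < e"
    using near[OF ab(1-4)] d(2) by (simp add: r_def)
  moreover have "\<bar>?h w v (x + a' *\<^sub>R w + b' *\<^sub>R v) - ?h w v x\<bar> < e"
    using near'[OF ab'(1-4)] d(4) by (simp add: r_def)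
  ultimately have "\<bar>?h v w x - ?h w v x\<bar> < e + e"
    by linarith
  then show False
    by (simp add: e_def)
qed

text \<open>A left inverse of the derivative of an immersion makes continuous lifts through it
  differentiable.\<close>

lemma has_derivative_lift:
  fixes f :: "'a::real_normed_vector \<Rightarrow> 'a" and g :: "'b::real_normed_vector \<Rightarrow> 'a"
  assumes f: "(f has_derivative (\<lambda>x. x)) (at (g z))"
    and g: "isCont g z"
    and fg: "((\<lambda>y. f (g y)) has_derivative k) (at z)"
  shows "(g has_derivative k) (at z)"
proof -
  interpret k: bounded_linear k
    using fg by (rule has_derivative_bounded_linear)
  obtain C where C: "C > 0" "\<And>x. norm (k x) \<le> norm x * C"
    using k.pos_bounded by blast
  have f_est: "\<forall>\<^sub>F y in at z. norm (f (g y) - f (g z) - (g y - g z)) \<le> e * norm (g y - g z)"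
    if "e > 0" for e
  proof -
    obtain d where d: "d > 0" "\<And>y. norm (y - g z) < d \<Longrightarrow> norm (f y - f (g z) - (y - g z)) \<le> e * norm (y - g z)"
      using f \<open>e > 0\<close> unfolding has_derivative_at_alt by blast
    have "\<forall>\<^sub>F y in at z. dist (g y) (g z) < d"
      using g d(1) unfolding isCont_def tendsto_iff by blast
    then show ?thesis
      by eventually_elim (use d in \<open>auto simp: dist_norm\<close>)
  qed
  have fg_est: "\<forall>\<^sub>F y in at z. norm (f (g y) - f (g z) - k (y - z)) \<le> e * norm (y - z)"
    if "e > 0" for e
  proof -
    obtain d where d: "d > 0" "\<And>y. norm (y - z) < d \<Longrightarrow> norm (f (g y) - f (g z) - k (y - z)) \<le> e * norm (y - z)"
      using fg \<open>e > 0\<close> unfolding has_derivative_at_alt by blast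
    then show ?thesis
      unfolding eventually_at by (intro exI[of _ d]) (auto simp: dist_norm)
  qed
  show ?thesis
    unfolding has_derivative_at_alt
  proof (intro conjI allI impI)
    show "bounded_linear k" by (rule k.bounded_linear_axioms)
    fix e :: real assume "e > 0"
    \<comment> \<open>The bound 1/2 lets the error \<open>e1 * norm (g y - g z)\<close> be absorbed
      on the left, which gives \<open>g\<close> the local Lipschitz bound
      \<open>2 * (C + 1)\<close>. With that bound the other entry of the minimum makes the same
      error at most half of the tolerance \<open>e\<close>.\<close>
    define e1 where "e1 = min (1/2) (e / (4 * (C + 1)))"
    have "e1 > 0" "e1 \<le> 1/2"
      using C(1) \<open>e > 0\<close> unfolding e1_def by (simp, linarith)
    moreover have "e1 * (2 * (C + 1)) \<le> e / 2"
    proof -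
      have "e1 * (2 * (C + 1)) \<le> e / (4 * (C + 1)) * (2 * (C + 1))"
        using C by (intro mult_right_mono) (auto simp: e1_def)
      also have "\<dots> = e / 2"
        using C by (simp add: divide_simps)
      finally show ?thesis .
    qed
    ultimately have e1: "e1 > 0" "e1 \<le> 1/2" "e1 * (2 * (C + 1)) \<le> e / 2" .
    have "\<forall>\<^sub>F y in at z. norm (g y - g z - k (y - z)) \<le> e * norm (y - z)"
      using f_est[OF e1(1)] fg_est[OF zero_less_one] fg_est[OF half_gt_zero[OF \<open>e > 0\<close>]]
    proof (eventually_elim)
      case (elim y)
      have fgb: "norm (f (g y) - f (g z)) \<le> (C + 1) * norm (y - z)"
        using norm_triangle_sub[of "f (g y) - f (g z)" "k (y - z)"] elim(2) C(2)[of "y - z"]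
        by (simp add: algebra_simps)
      have "norm (g y - g z) \<le> norm (f (g y) - f (g z)) + norm (f (g y) - f (g z) - (g y - g z))"
        by (metis norm_minus_commute norm_triangle_sub add.commute)
      also have "\<dots> \<le> (C + 1) * norm (y - z) + e1 * norm (g y - g z)"
        using fgb elim(1) by linarith
      also have "\<dots> \<le> (C + 1) * norm (y - z) + 1/2 * norm (g y - g z)"
        using e1 by (intro add_left_mono mult_right_mono) auto
      finally have "norm (g y - g z) \<le> 2 * (C + 1) * norm (y - z)"
        by (simp add: algebra_simps)
      then have "e1 * norm (g y - g z) \<le> e1 * (2 * (C + 1)) * norm (y - z)"
        using e1 by (simp add: mult.assoc)
      also have "\<dots> \<le> e / 2 * norm (y - z)"
        using e1 by (intro mult_right_mono) auto
      finally have "norm (f (g y) - f (g z) - (g y - g z)) \<le> e / 2 * norm (y - z)"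
        using elim(1) by linarith
      moreover have "norm (g y - g z - k (y - z)) \<le>
          norm (f (g y) - f (g z) - k (y - z)) + norm (f (g y) - f (g z) - (g y - g z))"
        using norm_triangle_ineq4[of "f (g y) - f (g z) - k (y - z)" "f (g y) - f (g z) - (g y - g z)"]
        by (simp add: algebra_simps)
      ultimately show ?case
        using elim(3) \<open>e > 0\<close> by (simp add: algebra_simps)
    qed
    then obtain d where d: "d > 0"
      "\<And>y. y \<noteq> z \<Longrightarrow> dist y z < d \<Longrightarrow> norm (g y - g z - k (y - z)) \<le> e * norm (y - z)"
      unfolding eventually_at by auto
    show "\<exists>d>0. \<forall>y. norm (y - z) < d \<longrightarrow> norm (g y - g z - k (y - z)) \<le> e * norm (y - z)"
    proof (intro exI[of _ d] conjI allI impI)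
      fix y assume "norm (y - z) < d"
      then show "norm (g y - g z - k (y - z)) \<le> e * norm (y - z)"
        using d(2)[of y] k.zero by (cases "y = z") (auto simp: dist_norm)
    qed (rule d(1))
  qed
qed

section \<open>Rigid motions\<close>

text \<open>The linear part of the motion, hence its derivative at every point. The extra terms of
  the third component are the group law term y_1 x_2 - x_1 y_2 for (k, l) and the rotated (x,
  y).\<close>

definition motion_deriv :: "real \<Rightarrow> real \<Rightarrow> real \<Rightarrow> real \<Rightarrow> heis \<Rightarrow> heis" where
  "motion_deriv a b k l =
     (\<lambda>(x, y, z). (a * x - b * y, b * x + a * y, z + (l * a - k * b) * x - (l * b + k * a) * y))"

text \<open>The rotation with matrix entries a, b about the z-axis, followed by the left translation
  by (k, l, m).\<close>

definition motion :: "real \<Rightarrow> real \<Rightarrow> real \<Rightarrow> real \<Rightarrow> real \<Rightarrow> heis \<Rightarrow> heis" where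
  "motion a b k l m = (\<lambda>p. (k, l, m) + motion_deriv a b k l p)"

lemma bounded_linear_motion_deriv: "bounded_linear (motion_deriv a b k l)"
proof -
  have "linear (motion_deriv a b k l)"
    by (rule linearI) (auto simp: motion_deriv_def algebra_simps split: prod.splits)
  then show ?thesis
    by (rule linear_conv_bounded_linear[THEN iffD1])
qed

lemma has_derivative_motion: "(motion a b k l m has_derivative motion_deriv a b k l) (at p)"
proof -
  have "((\<lambda>p. (k, l, m) + motion_deriv a b k l p) has_derivative (\<lambda>v. 0 + motion_deriv a b k l v)) (at p)"
    by (intro has_derivative_add has_derivative_const
        bounded_linear.has_derivative[OF bounded_linear_motion_deriv has_derivative_ident])
  then show ?thesis
    by (simp add: motion_def)
qed

lemma frechet_derivative_motion [simp]:
  "frechet_derivative (motion a b k l m) (at p) = motion_deriv a b k l"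
  by (rule frechet_derivative_eqI[OF has_derivative_motion])

lemma smooth_on_ident: "smooth_on S (\<lambda>x. x)"
  unfolding smooth_on_def
proof
  show "higher_differentiable_on S (\<lambda>x. x) n" for n
    by (cases n) (auto intro: higher_differentiable_on_const)
qed

lemma smooth_on_motion: "smooth_on UNIV (motion a b k l m)"
  unfolding motion_def
  by (intro smooth_on_affine bounded_linear_motion_deriv smooth_on_ident open_UNIV)

text \<open>Rotations are automorphisms of the group. So the inverse is the opposite rotation
  followed by the left translation by the rotated inverse element, and the new parameters are (-k,
  -l) turned back, together with -m.\<close>

lemma motion_inverse:
  assumes "a\<^sup>2 + b\<^sup>2 = 1"
  shows "motion a (-b) (- (a * k + b * l)) (b * k - a * l) (- m) (motion a b k l m p) = p"
proof -
  obtain x y z where p: "p = (x, y, z)" by (cases p)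
  have "a * (a * x - b * y + k) + b * (b * x + a * y + l) - (a * k + b * l) = x"
       "- b * (a * x - b * y + k) + a * (b * x + a * y + l) + (b * k - a * l) = y"
       "(b * k - a * l) * a - (- (a * k + b * l)) * (-b) = - l"
       "(b * k - a * l) * (-b) + (- (a * k + b * l)) * a = - k"
    using assms by algebra+
  note * = this
  show ?thesis
    unfolding p motion_def motion_deriv_def prod.case *(3,4)
    using *(1,2) by (simp add: algebra_simps)
qed

text \<open>The parameters of the inverse of the inverse are the original ones because
  \<open>a\<close> and \<open>b\<close> form a unit vector.\<close>

lemma motion_inverse':
  assumes "a\<^sup>2 + b\<^sup>2 = 1"
  shows "motion a b k l m (motion a (-b) (- (a * k + b * l)) (b * k - a * l) (- m) p) = p"
proof -
  have "motion a (-(-b)) (- (a * - (a * k + b * l) + - b * (b * k - a * l)))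
      (- b * - (a * k + b * l) - a * (b * k - a * l)) (- (- m))
      (motion a (-b) (- (a * k + b * l)) (b * k - a * l) (- m) p) = p"
    by (rule motion_inverse) (use assms in simp)
  moreover have "- (a * - (a * k + b * l) + - b * (b * k - a * l)) = (a\<^sup>2 + b\<^sup>2) * k"
      "- b * - (a * k + b * l) - a * (b * k - a * l) = (a\<^sup>2 + b\<^sup>2) * l"
    by (simp_all add: algebra_simps power2_eq_square)
  ultimately show ?thesis
    using assms by simp
qed

lemma bij_motion: "a\<^sup>2 + b\<^sup>2 = 1 \<Longrightarrow> bij (motion a b k l m)"
  by (rule o_bij[of "motion a (-b) (- (a * k + b * l)) (b * k - a * l) (- m)"])
    (simp_all only: fun_eq_iff o_apply id_apply motion_inverse motion_inverse' simp_thms)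

lemma inv_motion:
  "a\<^sup>2 + b\<^sup>2 = 1 \<Longrightarrow>
    inv (motion a b k l m) = motion a (-b) (- (a * k + b * l)) (b * k - a * l) (- m)"
  by (rule inv_unique_comp) (simp_all only: fun_eq_iff o_apply id_apply motion_inverse motion_inverse' simp_thms)

text \<open>Left translations preserve the left invariant frame, and the rotation turns its first
  two fields while fixing the Reeb field. Hence only the rotation, which is
  \<open>motion_deriv a b 0 0\<close>, acts on the coefficients.\<close>

lemma frame_coords_motion:
  assumes "a\<^sup>2 + b\<^sup>2 = 1"
  shows "frame_coords (motion a b k l m p) (motion_deriv a b k l v) =
    motion_deriv a b 0 0 (frame_coords p v)"
proof -
  obtain x y z where p: "p = (x, y, z)" by (cases p)
  obtain v1 v2 v3 where v: "v = (v1, v2, v3)" by (cases v)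
  have "(v2 * x - v1 * y) * (a\<^sup>2 + b\<^sup>2) = v2 * x - v1 * y"
    using assms by simp
  then show ?thesis
    unfolding p v frame_coords_def contact_form_def motion_def motion_deriv_def
    by (simp add: algebra_simps power2_eq_square)
qed

lemma contact_form_motion:
  assumes "a\<^sup>2 + b\<^sup>2 = 1"
  shows "contact_form (motion a b k l m p) (motion_deriv a b k l v) = contact_form p v"
  using frame_coords_motion[OF assms, of k l m p v]
  by (simp add: frame_coords_def motion_deriv_def)

lemma inj_frame_coords: "frame_coords p v = frame_coords p w \<Longrightarrow> v = w"
  by (cases p; cases v; cases w) (auto simp: frame_coords_def contact_form_def)

lemma frame_coords_J: "frame_coords p (J p v) = (- fst (snd v), fst v, 0)"
  by (cases p; cases v)
    (auto simp: frame_coords_def contact_form_def J_def frame1_def frame2_def)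

lemma J_motion:
  assumes "a\<^sup>2 + b\<^sup>2 = 1"
  shows "J (motion a b k l m p) (motion_deriv a b k l v) = motion_deriv a b k l (J p v)"
  by (rule inj_frame_coords[of "motion a b k l m p"])
    (simp add: frame_coords_motion[OF assms] frame_coords_J, cases v, simp add: motion_deriv_def)

lemma adapted_metric_motion:
  assumes "a\<^sup>2 + b\<^sup>2 = 1"
  shows "adapted_metric (motion a b k l m p) (motion_deriv a b k l v) (motion_deriv a b k l w) =
    adapted_metric p v w"
proof -
  obtain x1 x2 x3 where v: "frame_coords p v = (x1, x2, x3)" by (cases "frame_coords p v")
  obtain y1 y2 y3 where w: "frame_coords p w = (y1, y2, y3)" by (cases "frame_coords p w")
  have "(x1 * y1 + x2 * y2) * (a\<^sup>2 + b\<^sup>2) = x1 * y1 + x2 * y2"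
    using assms by simp
  then show ?thesis
    unfolding adapted_metric_def frame_coords_motion[OF assms] v w
    by (simp add: motion_deriv_def algebra_simps power2_eq_square)
qed

lemma motion_deriv_reeb: "motion_deriv a b k l (reeb p) = reeb q"
  by (simp add: motion_deriv_def reeb_def)

lemma heis_rigid_motion_motion:
  assumes "a\<^sup>2 + b\<^sup>2 = 1"
  shows "heis_rigid_motion (motion a b k l m)"
  unfolding heis_rigid_motion_def
  by (simp add: bij_motion smooth_on_motion inv_motion contact_form_motion J_motion assms)

section \<open>Classification of the rigid motions\<close>

lemma linear_prod3:
  fixes g :: "heis \<Rightarrow> 'b::real_vector"
  assumes "linear g"
  shows "g (x, y, z) = x *\<^sub>R g (1, 0, 0) + y *\<^sub>R g (0, 1, 0) + z *\<^sub>R g (0, 0, 1)"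
proof -
  have "(x, y, z) = x *\<^sub>R (1, 0, 0) + y *\<^sub>R (0, 1, 0) + z *\<^sub>R (0, 0, 1::real)"
    by simp
  then have "g (x, y, z) = g (x *\<^sub>R (1, 0, 0) + y *\<^sub>R (0, 1, 0) + z *\<^sub>R (0, 0, 1))"
    by (rule arg_cong)
  then show ?thesis
    by (simp only: linear_add[OF assms] linear_scale[OF assms])
qed

lemma constant_derivative_imp_affine:
  fixes f :: "'a::real_normed_vector \<Rightarrow> 'b::real_normed_vector"
  assumes "\<And>p. (f has_derivative L) (at p)"
  shows "\<exists>c. \<forall>p. f p = L p + c"
proof -
  have L: "bounded_linear L"
    using assms has_derivative_bounded_linear by blast
  have "((\<lambda>p. f p - L p) has_derivative (\<lambda>_. 0)) (at p)" for p
    using has_derivative_diff[OF assms bounded_linear.has_derivative[OF L has_derivative_ident]]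
    by simp
  then obtain c where c: "\<And>p. f p - L p = c"
    using has_derivative_zero_constant[of UNIV "\<lambda>p. f p - L p"] by auto
  have "f p = L p + c" for p
    using c[of p] by (simp add: algebra_simps)
  then show ?thesis by blast
qed

lemma heis_rigid_motionD:
  assumes "heis_rigid_motion F"
  shows "smooth_on UNIV F"
    "contact_form (F p) (frechet_derivative F (at p) v) = contact_form p v"
    "v \<in> contact_plane p \<Longrightarrow>
      J (F p) (frechet_derivative F (at p) v) = frechet_derivative F (at p) (J p v)"
  using assms unfolding heis_rigid_motion_def by blast+

text \<open>Pulling back $d\Theta = 2\,dx \wedge dy$ forces the first two components of a rigid motion
  not to depend on z; since it commutes with J, they form a holomorphic function of $x + iy$ with
  a derivative of modulus 1.\<close>

lemma heis_rigid_motion_imp_motion: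
  assumes "heis_rigid_motion F"
  obtains a b k l m where "a\<^sup>2 + b\<^sup>2 = 1" "F = motion a b k l m"
proof -
  define f g h where fgh: "f = (\<lambda>p. fst (F p))" "g = (\<lambda>p. fst (snd (F p)))" "h = (\<lambda>p. snd (snd (F p)))"
  have F: "F p = (f p, g p, h p)" for p
    by (simp add: fgh)
  have smF: "smooth_on UNIV F"
    by (rule heis_rigid_motionD(1)[OF assms])
  have sm: "smooth_on UNIV f" "smooth_on UNIV g" "smooth_on UNIV h"
    unfolding fgh
    by (rule smooth_on_linear[OF open_UNIV _ smF], simp add: bounded_linear_fst bounded_linear_fst_comp bounded_linear_snd_comp bounded_linear_snd)+
  define Df where "Df = (\<lambda>p. frechet_derivative f (at p))"
  define Dg where "Dg = (\<lambda>p. frechet_derivative g (at p))"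
  define Dh where "Dh = (\<lambda>p. frechet_derivative h (at p))"
  have der: "(f has_derivative Df p) (at p)" "(g has_derivative Dg p) (at p)"
      "(h has_derivative Dh p) (at p)" for p
    using sm[THEN smooth_on_has_derivative] by (auto simp: Df_def Dg_def Dh_def)
  define D2f where "D2f = (\<lambda>p v. frechet_derivative (\<lambda>p. Df p v) (at p))"
  define D2g where "D2g = (\<lambda>p v. frechet_derivative (\<lambda>p. Dg p v) (at p))"
  have der2: "((\<lambda>p. Df p v) has_derivative D2f p v) (at p)"
     "((\<lambda>p. Dg p v) has_derivative D2g p v) (at p)" for p v
    using sm(1,2)[THEN smooth_on_frechet_derivative, THEN smooth_on_has_derivative]
    by (auto simp: Df_def Dg_def D2f_def D2g_def)
  have sym: "D2f p v w = D2f p w v" "D2g p v w = D2g p w v" for p v w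
    using sm(1,2)[THEN symmetric_second_derivative[OF _ open_UNIV UNIV_I]]
    by (auto simp: Df_def Dg_def D2f_def D2g_def)
  have lin: "linear (Df p)" "linear (Dg p)" "linear (Dh p)" "linear (D2f p v)" "linear (D2g p v)" for p v
    using der der2 has_derivative_linear by blast+
  have DF: "frechet_derivative F (at p) v = (Df p v, Dg p v, Dh p v)" for p v
  proof -
    have "((\<lambda>p. (f p, g p, h p)) has_derivative (\<lambda>v. (Df p v, Dg p v, Dh p v))) (at p)"
      by (intro has_derivative_Pair der)
    then show ?thesis
      unfolding F[symmetric] by (simp add: frechet_derivative_eqI)
  qed
  have contact: "Dh p v = contact_form p v - f p * Dg p v + g p * Df p v" for p v
  proof -
    have "contact_form (F p) (frechet_derivative F (at p) v) = contact_form p v"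
      by (rule heis_rigid_motionD(2)[OF assms])
    then have "Dh p v + f p * Dg p v - g p * Df p v = contact_form p v"
      unfolding DF F[of p] by (simp add: contact_form_def)
    then show ?thesis by simp
  qed
  \<comment> \<open>Differentiate \<open>contact\<close> in direction \<open>w\<close> and
    antisymmetrize in \<open>v\<close> and \<open>w\<close>: the second derivatives of all three
    components are symmetric and drop out, leaving the pullback of the area form.\<close>
  have area: "Df p w * Dg p v - Dg p w * Df p v = fst w * fst (snd v) - fst (snd w) * fst v" for p v w
  proof -
    have "((\<lambda>p. Dh p v) has_derivative (\<lambda>w. fst w * fst (snd v) - fst (snd w) * fst v
        - (f p * D2g p v w + Df p w * Dg p v) + (g p * D2f p v w + Dg p w * Df p v))) (at p)" for p v
      unfolding contact contact_form_def case_prod_beta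
      by (auto intro!: derivative_eq_intros der der2)
    then have "frechet_derivative (\<lambda>p. Dh p v) (at p) w = fst w * fst (snd v) - fst (snd w) * fst v
        - (f p * D2g p v w + Df p w * Dg p v) + (g p * D2f p v w + Dg p w * Df p v)" for p v w
      by (subst frechet_derivative_eqI) auto
    from this[of v p w] this[of w p v] have ?thesis if
       "frechet_derivative (\<lambda>p. Dh p v) (at p) w = frechet_derivative (\<lambda>p. Dh p w) (at p) v"
      using that sym[of p v w] by (simp add: algebra_simps)
    moreover have "frechet_derivative (\<lambda>p. Dh p v) (at p) w = frechet_derivative (\<lambda>p. Dh p w) (at p) v"
      unfolding Dh_def by (rule symmetric_second_derivative[OF sm(3) open_UNIV UNIV_I])
    ultimately show ?thesis .
  qed
  let ?x = "(1, 0, 0) :: heis" and ?y = "(0, 1, 0) :: heis" and ?z = "(0, 0, 1) :: heis"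
  have zz: "Df p ?z = 0 \<and> Dg p ?z = 0" for p
  proof -
    have 1: "Df p ?x * Dg p ?y - Dg p ?x * Df p ?y = 1"
      using area[of p ?x ?y] by simp
    have 2: "Df p ?x * Dg p ?z = Dg p ?x * Df p ?z" "Df p ?y * Dg p ?z = Dg p ?y * Df p ?z"
      using area[of p ?x ?z] area[of p ?y ?z] by simp_all
    \<comment> \<open>Multiplying by the minor in x and y, which is 1, makes the two vanishing
      minors with z applicable.\<close>
    have "Df p ?z = Df p ?z * (Df p ?x * Dg p ?y - Dg p ?x * Df p ?y)"
         "Dg p ?z = Dg p ?z * (Df p ?x * Dg p ?y - Dg p ?x * Df p ?y)"
      using 1 by simp_all
    then show ?thesis using 2 by algebra
  qed
  \<comment> \<open>As the first two components do not depend on z, the frame fields act on them as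
    the x and y derivatives. Commuting with \<open>J\<close> then amounts to the Cauchy-Riemann
    equations.\<close>
  have CR: "Df p ?y = - Dg p ?x" "Dg p ?y = Df p ?x" for p
  proof -
    have "J (F p) (frechet_derivative F (at p) (frame1 p)) = frechet_derivative F (at p) (J p (frame1 p))"
      by (rule heis_rigid_motionD(3)[OF assms])
        (simp add: frame1_def contact_plane_def contact_form_def split: prod.splits)
    moreover have "J p (frame1 p) = frame2 p"
      by (simp add: frame1_def frame2_def J_def split: prod.splits)
    ultimately have "- Dg p (frame1 p) = Df p (frame2 p)" "Df p (frame1 p) = Dg p (frame2 p)"
      by (auto simp: DF J_def F frame1_def frame2_def split: prod.splits)
    moreover have "Df p (frame1 p) = Df p ?x" "Dg p (frame1 p) = Dg p ?x"
       "Df p (frame2 p) = Df p ?y" "Dg p (frame2 p) = Dg p ?y"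
      using lin(1,2)[of p, THEN linear_prod3, of 1 0 "fst (snd p)"]
        lin(1,2)[of p, THEN linear_prod3, of 0 1 "- fst p"] zz[of p]
      by (simp_all add: frame1_def frame2_def case_prod_beta)
    ultimately show "Df p ?y = - Dg p ?x" "Dg p ?y = Df p ?x" by simp_all
  qed
  have norm1: "(Df p ?x)\<^sup>2 + (Dg p ?x)\<^sup>2 = 1" for p
    using area[of p ?x ?y] by (simp add: CR power2_eq_square)
  have D2: "D2f p ?x v = 0 \<and> D2g p ?x v = 0" for p v
  proof -
    have orth: "Df p ?x * D2f p ?x v + Dg p ?x * D2g p ?x v = 0" for v
    proof -
      have "((\<lambda>p. (Df p ?x)\<^sup>2 + (Dg p ?x)\<^sup>2) has_derivative
          (\<lambda>v. 2 * (Df p ?x * D2f p ?x v + Dg p ?x * D2g p ?x v))) (at p)"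
        by (auto intro!: derivative_eq_intros der2 simp: algebra_simps)
      then have "((\<lambda>p. 1) has_derivative
          (\<lambda>v. 2 * (Df p ?x * D2f p ?x v + Dg p ?x * D2g p ?x v))) (at p)"
        by (simp only: norm1)
      from fun_cong[OF has_derivative_unique[OF this has_derivative_const], of v] show ?thesis
        by simp
    qed
    have dy: "D2f p ?x ?y = - D2g p ?x ?x" "D2g p ?x ?y = D2f p ?x ?x"
    proof -
      have "((\<lambda>p. Df p ?y) has_derivative (\<lambda>v. - D2g p ?x v)) (at p)"
        unfolding CR by (intro has_derivative_minus der2)
      from fun_cong[OF has_derivative_unique[OF der2(1) this], of ?x]
      show "D2f p ?x ?y = - D2g p ?x ?x"
        by (simp add: sym(1)[of p ?x ?y])
      have "((\<lambda>p. Dg p ?y) has_derivative D2f p ?x) (at p)"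
        unfolding CR by (rule der2)
      from fun_cong[OF has_derivative_unique[OF der2(2) this], of ?x]
      show "D2g p ?x ?y = D2f p ?x ?x"
        by (simp add: sym(2)[of p ?x ?y])
    qed
    have dz: "D2f p ?x ?z = 0" "D2g p ?x ?z = 0"
    proof -
      have "((\<lambda>p. Df p ?z) has_derivative (\<lambda>v. 0)) (at p)" "((\<lambda>p. Dg p ?z) has_derivative (\<lambda>v. 0)) (at p)"
        by (simp_all add: zz)
      from fun_cong[OF has_derivative_unique[OF der2(1) this(1)], of ?x]
        fun_cong[OF has_derivative_unique[OF der2(2) this(2)], of ?x]
      show "D2f p ?x ?z = 0" "D2g p ?x ?z = 0"
        by (simp_all add: sym[of p ?x ?z])
    qed
    \<comment> \<open>By \<open>dy\<close>, the relations \<open>orth\<close> at the x and y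
      directions form a homogeneous linear system for the two second derivatives in x; up to sign
      its determinant is the squared norm from \<open>norm1\<close>, which is 1.\<close>
    have "D2f p ?x ?x = D2f p ?x ?x * ((Df p ?x)\<^sup>2 + (Dg p ?x)\<^sup>2)"
         "D2g p ?x ?x = D2g p ?x ?x * ((Df p ?x)\<^sup>2 + (Dg p ?x)\<^sup>2)"
      by (simp_all add: norm1)
    then have dx: "D2f p ?x ?x = 0 \<and> D2g p ?x ?x = 0"
      using orth[of ?x] orth[of ?y] unfolding dy by algebra
    show ?thesis
      using lin(4,5)[of p ?x, THEN linear_prod3, of "fst v" "fst (snd v)" "snd (snd v)"] dx dy dz
      by simp
  qed
  have D2_zero: "D2f p ?x = (\<lambda>_. 0)" "D2g p ?x = (\<lambda>_. 0)" for p
    by (rule ext, simp only: D2)+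
  obtain a where a: "\<And>p. Df p ?x = a"
    using constant_derivative_imp_affine[OF der2(1)[where v = "?x", unfolded D2_zero], unfolded add_0]
    by blast
  obtain b where b: "\<And>p. Dg p ?x = b"
    using constant_derivative_imp_affine[OF der2(2)[where v = "?x", unfolded D2_zero], unfolded add_0]
    by blast
  have ab: "a\<^sup>2 + b\<^sup>2 = 1"
    using norm1[of 0] by (simp add: a b)
  have Df: "Df p = (\<lambda>v. a * fst v - b * fst (snd v))" for p
  proof
    fix v :: heis
    show "Df p v = a * fst v - b * fst (snd v)"
      using lin(1)[of p, THEN linear_prod3, of "fst v" "fst (snd v)" "snd (snd v)"] zz[of p]
      by (simp add: a b CR)
  qed
  have Dg: "Dg p = (\<lambda>v. b * fst v + a * fst (snd v))" for p
  proof
    fix v :: heis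
    show "Dg p v = b * fst v + a * fst (snd v)"
      using lin(2)[of p, THEN linear_prod3, of "fst v" "fst (snd v)" "snd (snd v)"] zz[of p]
      by (simp add: a b CR)
  qed
  obtain k where k: "\<And>p. f p = a * fst p - b * fst (snd p) + k"
    using constant_derivative_imp_affine[OF der(1)[unfolded Df]] by blast
  obtain l where l: "\<And>p. g p = b * fst p + a * fst (snd p) + l"
    using constant_derivative_imp_affine[OF der(2)[unfolded Dg]] by blast
  have Dh: "Dh p = (\<lambda>v. snd (snd v) + (l * a - k * b) * fst v - (l * b + k * a) * fst (snd v))" for p
  proof
    fix v :: heis
    \<comment> \<open>With the affine first two components inserted into \<open>contact\<close>, the
      terms depending on \<open>p\<close> cancel exactly because the rotation preserves this area
      expression.\<close>
    have "(fst p * fst (snd v) - fst (snd p) * fst v) * (a\<^sup>2 + b\<^sup>2) = fst p * fst (snd v) - fst (snd p) * fst v"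
      using ab by simp
    then show "Dh p v = snd (snd v) + (l * a - k * b) * fst v - (l * b + k * a) * fst (snd v)"
      unfolding contact Df Dg k l contact_form_def case_prod_beta
      by (simp add: algebra_simps power2_eq_square)
  qed
  obtain m where m: "\<And>p. h p = snd (snd p) + (l * a - k * b) * fst p - (l * b + k * a) * fst (snd p) + m"
    using constant_derivative_imp_affine[OF der(3)[unfolded Dh]] by blast
  have "F = motion a b k l m"
    by (rule ext) (simp add: F k l m motion_def motion_deriv_def case_prod_beta)
  with ab show thesis
    by (rule that)
qed

section \<open>Transport of curves, tangent spaces, curvature and coordinates by a motion\<close>

lemma inverse_coeffs: "a\<^sup>2 + b\<^sup>2 = (1::real) \<Longrightarrow> a\<^sup>2 + (- b)\<^sup>2 = 1"
  by simp

lemma motion_deriv_inverse: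
  assumes "a\<^sup>2 + b\<^sup>2 = 1"
  shows "motion_deriv a (-b) (- (a * k + b * l)) (b * k - a * l) (motion_deriv a b k l v) = v"
    and "motion_deriv a b k l (motion_deriv a (-b) (- (a * k + b * l)) (b * k - a * l) v) = v"
proof -
  define k' l' where k'l': "k' = - (a * k + b * l)" "l' = b * k - a * l"
  interpret L: bounded_linear "motion_deriv a b k l" by (rule bounded_linear_motion_deriv)
  interpret M: bounded_linear "motion_deriv a (-b) k' l'" by (rule bounded_linear_motion_deriv)
  \<comment> \<open>The linear parts are mutually inverse because the affine maps are: compare the
    values at \<open>v\<close> and at 0.\<close>
  note inv = motion_inverse[OF assms, of k l 0, folded k'l', unfolded motion_def M.add, folded add.assoc]
    motion_inverse'[OF assms, of k l 0, folded k'l', unfolded motion_def L.add, folded add.assoc]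
  show "motion_deriv a (-b) (- (a * k + b * l)) (b * k - a * l) (motion_deriv a b k l v) = v"
    unfolding k'l'[symmetric] using inv(1)[of v] inv(1)[of 0] by (simp add: L.zero M.zero)
  show "motion_deriv a b k l (motion_deriv a (-b) (- (a * k + b * l)) (b * k - a * l) v) = v"
    unfolding k'l'[symmetric] using inv(2)[of v] inv(2)[of 0] by (simp add: L.zero M.zero)
qed

lemma curve_in_motion:
  assumes "curve_in S p v \<gamma>"
  shows "curve_in (motion a b k l m ` S) (motion a b k l m p) (motion_deriv a b k l v)
    (\<lambda>t. motion a b k l m (\<gamma> t))"
proof -
  obtain r where r: "r > 0" "smooth_on {-r<..<r} \<gamma>" "\<gamma> ` {-r<..<r} \<subseteq> S"
    and \<gamma>: "\<gamma> 0 = p" "(\<gamma> has_vector_derivative v) (at 0)"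
    using assms unfolding curve_in_def by blast
  have "smooth_on {-r<..<r} (\<lambda>t. motion a b k l m (\<gamma> t))"
    unfolding motion_def
    by (intro smooth_on_affine bounded_linear_motion_deriv r open_greaterThanLessThan)
  moreover have "((\<lambda>t. motion a b k l m (\<gamma> t)) has_vector_derivative 0 + motion_deriv a b k l v) (at 0)"
    unfolding motion_def
    by (intro has_vector_derivative_add has_vector_derivative_const
        bounded_linear.has_vector_derivative[OF bounded_linear_motion_deriv] \<gamma>)
  moreover have "(\<lambda>t. motion a b k l m (\<gamma> t)) ` {-r<..<r} \<subseteq> motion a b k l m ` S"
    using r(3) by blast
  ultimately show ?thesis
    unfolding curve_in_def using r(1) \<gamma>(1) by auto
qed

lemma curve_in_motion_inverse:
  assumes "a\<^sup>2 + b\<^sup>2 = 1" and "curve_in (motion a b k l m ` S) (motion a b k l m p) (motion_deriv a b k l v) \<gamma>"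
  shows "curve_in S p v (\<lambda>t. motion a (-b) (- (a * k + b * l)) (b * k - a * l) (- m) (\<gamma> t))"
  using curve_in_motion[OF assms(2), of a "-b" "- (a * k + b * l)" "b * k - a * l" "- m"]
  by (simp only: image_image motion_inverse[OF assms(1)] image_ident motion_deriv_inverse[OF assms(1)])

lemma tangent_space_motion:
  assumes "a\<^sup>2 + b\<^sup>2 = 1"
  shows "tangent_space (motion a b k l m ` S) (motion a b k l m p) =
    motion_deriv a b k l ` tangent_space S p"
proof (intro set_eqI iffI)
  fix w assume "w \<in> tangent_space (motion a b k l m ` S) (motion a b k l m p)"
  then obtain \<gamma> where "curve_in (motion a b k l m ` S) (motion a b k l m p) w \<gamma>"
    by (auto simp: tangent_space_def)
  then have "curve_in (motion a b k l m ` S) (motion a b k l m p)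
      (motion_deriv a b k l (motion_deriv a (-b) (- (a * k + b * l)) (b * k - a * l) w)) \<gamma>"
    by (simp only: motion_deriv_inverse[OF assms])
  from curve_in_motion_inverse[OF assms this]
  have "motion_deriv a (-b) (- (a * k + b * l)) (b * k - a * l) w \<in> tangent_space S p"
    unfolding tangent_space_def by blast
  then show "w \<in> motion_deriv a b k l ` tangent_space S p"
    by (rule rev_image_eqI) (simp only: motion_deriv_inverse[OF assms])
next
  fix w assume "w \<in> motion_deriv a b k l ` tangent_space S p"
  then obtain v \<gamma> where "w = motion_deriv a b k l v" "curve_in S p v \<gamma>"
    unfolding tangent_space_def by blast
  then show "w \<in> tangent_space (motion a b k l m ` S) (motion a b k l m p)"
    using curve_in_motion unfolding tangent_space_def by blast
qed

lemma inj_motion_deriv: "a\<^sup>2 + b\<^sup>2 = 1 \<Longrightarrow> inj (motion_deriv a b k l)"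
  by (rule inj_on_inverseI) (rule motion_deriv_inverse)

lemma has_derivative_motion_compose:
  assumes "(X has_derivative X') (at u)"
  shows "((\<lambda>u. motion a b k l m (X u)) has_derivative (\<lambda>v. motion_deriv a b k l (X' v))) (at u)"
  using has_derivative_compose[OF assms has_derivative_motion] .

lemma local_param_motion:
  assumes ab: "a\<^sup>2 + b\<^sup>2 = 1" and X: "local_param S U X"
  shows "local_param (motion a b k l m ` S) U (\<lambda>u. motion a b k l m (X u))"
proof -
  let ?F = "motion a b k l m"
  obtain g where U: "open U" "smooth_on U X" "\<forall>u\<in>U. inj (frechet_derivative X (at u))"
    "openin (top_of_set S) (X ` U)" "homeomorphism U (X ` U) X g"
    using X unfolding local_param_def by blast
  have cont: "continuous_on A (motion a b k l m)" for A a b k l m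
    using has_derivative_continuous[OF has_derivative_motion]
    by (simp add: continuous_at_imp_continuous_on)
  have hom: "homeomorphism A (?F ` A) ?F (motion a (-b) (- (a * k + b * l)) (b * k - a * l) (- m))" for A
    by (rule homeomorphismI)
      (simp_all only: cont image_image motion_inverse[OF ab] motion_inverse'[OF ab] image_ident subset_refl)
  have "smooth_on U (\<lambda>u. ?F (X u))"
    unfolding motion_def by (intro smooth_on_affine bounded_linear_motion_deriv U)
  moreover have "inj (frechet_derivative (\<lambda>u. ?F (X u)) (at u))" if "u \<in> U" for u
    using frechet_derivative_eqI[OF has_derivative_motion_compose[OF smooth_on_has_derivative[OF U(2) that]]]
      inj_compose[OF inj_motion_deriv[OF ab], of "frechet_derivative X (at u)" k l] U(3) that
    by (simp add: comp_def)
  moreover have "openin (top_of_set (?F ` S)) (?F ` X ` U)"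
    by (rule homeomorphism_imp_open_map[OF hom U(4)])
  moreover have "homeomorphism U (?F ` X ` U) (?F \<circ> X)
      (g \<circ> motion a (-b) (- (a * k + b * l)) (b * k - a * l) (- m))"
    by (rule homeomorphism_compose[OF U(5) hom])
  ultimately show ?thesis
    using U(1) unfolding local_param_def comp_def by (auto simp: image_image)
qed

lemma local_param_motion_inverse:
  assumes "a\<^sup>2 + b\<^sup>2 = 1" and "local_param (motion a b k l m ` S) U X"
  shows "local_param S U (\<lambda>u. motion a (-b) (- (a * k + b * l)) (b * k - a * l) (- m) (X u))"
  using local_param_motion[OF inverse_coeffs[OF assms(1)] assms(2), of "- (a * k + b * l)" "b * k - a * l" "- m"]
  by (simp only: image_image motion_inverse[OF assms(1)] image_ident)

lemma push_forward_motion: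
  "a\<^sup>2 + b\<^sup>2 = 1 \<Longrightarrow> push_forward (motion a b k l m) V q =
    motion_deriv a b k l (V (motion a (-b) (- (a * k + b * l)) (b * k - a * l) (- m) q))"
  by (simp add: push_forward_def inv_motion)

lemma push_forward_motion_image:
  "a\<^sup>2 + b\<^sup>2 = 1 \<Longrightarrow> push_forward (motion a b k l m) V (motion a b k l m p) = motion_deriv a b k l (V p)"
  by (simp only: push_forward_motion motion_inverse)

lemma e2_field_push_forward:
  assumes "a\<^sup>2 + b\<^sup>2 = 1"
  shows "e2_field (push_forward (motion a b k l m) E) = push_forward (motion a b k l m) (e2_field E)"
proof
  fix q
  obtain p where "q = motion a b k l m p"
    using motion_inverse'[OF assms] by metis
  then show "e2_field (push_forward (motion a b k l m) E) q = push_forward (motion a b k l m) (e2_field E) q"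
    by (simp only: push_forward_motion_image[OF assms] J_motion[OF assms])
qed

text \<open>A curve in the image surface is pulled back by the inverse motion, so the hypothesis
  about all curves applies to it. On frame coefficients the motion is a constant linear map, which
  commutes with differentiation along the curve.\<close>

lemma has_nabla_motion:
  assumes ab: "a\<^sup>2 + b\<^sup>2 = 1" and "has_nabla S V p v w"
  shows "has_nabla (motion a b k l m ` S) (push_forward (motion a b k l m) V) (motion a b k l m p)
    (motion_deriv a b k l v) (motion_deriv a b k l w)"
  unfolding has_nabla_def
proof (intro conjI allI impI)
  let ?F = "motion a b k l m" and ?G = "motion a (-b) (- (a * k + b * l)) (b * k - a * l) (- m)"
  show "motion_deriv a b k l v \<in> tangent_space (?F ` S) (?F p)"
    using assms by (simp add: tangent_space_motion has_nabla_def)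
  fix \<gamma> assume "curve_in (?F ` S) (?F p) (motion_deriv a b k l v) \<gamma>"
  then have "curve_in S p v (\<lambda>t. ?G (\<gamma> t))"
    by (rule curve_in_motion_inverse[OF ab])
  then have "((\<lambda>t. frame_coords (?G (\<gamma> t)) (V (?G (\<gamma> t)))) has_vector_derivative frame_coords p w) (at 0)"
    using assms(2) by (simp add: has_nabla_def)
  then have "((\<lambda>t. motion_deriv a b 0 0 (frame_coords (?G (\<gamma> t)) (V (?G (\<gamma> t))))) has_vector_derivative
      motion_deriv a b 0 0 (frame_coords p w)) (at 0)"
    by (rule bounded_linear.has_vector_derivative[OF bounded_linear_motion_deriv])
  then show "((\<lambda>t. frame_coords (\<gamma> t) (push_forward ?F V (\<gamma> t))) has_vector_derivative
      frame_coords (?F p) (motion_deriv a b k l w)) (at 0)"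
    unfolding frame_coords_motion[OF ab, symmetric, where k = k and l = l and m = m]
    by (simp only: motion_inverse'[OF ab] push_forward_motion[OF ab])
qed

text \<open>The two \<open>THE\<close> descriptions have equivalent predicates, since the derivative
  of the motion is injective and fixes the Reeb field.\<close>

lemma alpha_motion:
  assumes "a\<^sup>2 + b\<^sup>2 = 1"
  shows "alpha (motion a b k l m ` S) (push_forward (motion a b k l m) E) (motion a b k l m p) = alpha S E p"
proof -
  interpret L: bounded_linear "motion_deriv a b k l" by (rule bounded_linear_motion_deriv)
  have "c *\<^sub>R motion_deriv a b k l (J p (E p)) + reeb (motion a b k l m p) =
      motion_deriv a b k l (c *\<^sub>R J p (E p) + reeb p)" for c
    by (simp add: L.add L.scaleR motion_deriv_reeb[of _ _ _ _ p "motion a b k l m p"])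
  then show ?thesis
    unfolding alpha_def push_forward_motion_image[OF assms] J_motion[OF assms] tangent_space_motion[OF assms]
    by (simp add: inj_image_mem_iff[OF inj_motion_deriv[OF assms]])
qed

lemma e2_hat_motion:
  assumes "a\<^sup>2 + b\<^sup>2 = 1"
  shows "e2_hat (motion a b k l m ` S) (push_forward (motion a b k l m) E) (motion a b k l m p) =
    motion_deriv a b k l (e2_hat S E p)"
proof -
  interpret L: bounded_linear "motion_deriv a b k l" by (rule bounded_linear_motion_deriv)
  show ?thesis
    unfolding e2_hat_def alpha_motion[OF assms] push_forward_motion_image[OF assms] J_motion[OF assms]
    by (simp add: L.add L.scaleR motion_deriv_reeb[of _ _ _ _ p "motion a b k l m p"])
qed

lemma contact_plane_motion:
  assumes "a\<^sup>2 + b\<^sup>2 = 1"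
  shows "contact_plane (motion a b k l m p) = motion_deriv a b k l ` contact_plane p"
proof (intro set_eqI iffI)
  fix w assume w: "w \<in> contact_plane (motion a b k l m p)"
  obtain v where v: "w = motion_deriv a b k l v"
    using motion_deriv_inverse(2)[OF assms] by metis
  then show "w \<in> motion_deriv a b k l ` contact_plane p"
    using w by (auto simp: contact_plane_def contact_form_motion[OF assms])
qed (auto simp: contact_plane_def contact_form_motion[OF assms])

lemma cpmc_surface_motion:
  assumes ab: "a\<^sup>2 + b\<^sup>2 = 1" and S: "cpmc_surface r S E"
  shows "cpmc_surface r (motion a b k l m ` S) (push_forward (motion a b k l m) E)"
proof -
  let ?F = "motion a b k l m" and ?L = "motion_deriv a b k l"
  interpret L: bounded_linear ?L by (rule bounded_linear_motion_deriv)
  have ns: "nonsingular_surface S E"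
    using S by (simp add: cpmc_surface_def)
  have "smooth_surface (?F ` S)"
    unfolding smooth_surface_def
  proof
    fix q assume "q \<in> ?F ` S"
    then obtain p where p: "p \<in> S" "q = ?F p" by blast
    then obtain U X where "local_param S U X" "p \<in> X ` U"
      using ns unfolding nonsingular_surface_def smooth_surface_def by blast
    then show "\<exists>U X. local_param (?F ` S) U X \<and> q \<in> X ` U"
      using local_param_motion[OF ab] p(2) by blast
  qed
  moreover have "\<forall>q\<in>?F ` S. tangent_space (?F ` S) q \<noteq> contact_plane q"
    using ns inj_image_eq_iff[OF inj_motion_deriv[OF ab]]
    by (auto simp: tangent_space_motion[OF ab] contact_plane_motion[OF ab] nonsingular_surface_def)
  moreover have "smooth_field_along (?F ` S) (push_forward ?F E)"
    unfolding smooth_field_along_def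
  proof (intro allI impI)
    fix U X assume X: "local_param (?F ` S) U X"
    have "open U"
      using X by (simp add: local_param_def)
    have "smooth_on U (E \<circ> (\<lambda>u. motion a (-b) (- (a * k + b * l)) (b * k - a * l) (- m) (X u)))"
      using ns local_param_motion_inverse[OF ab X]
      unfolding nonsingular_surface_def smooth_field_along_def by blast
    from smooth_on_linear[OF \<open>open U\<close> bounded_linear_motion_deriv this]
    show "smooth_on U (push_forward ?F E \<circ> X)"
      by (simp add: comp_def push_forward_motion[OF ab])
  qed
  moreover have "\<forall>q\<in>?F ` S. push_forward ?F E q \<in> tangent_space (?F ` S) q \<inter> contact_plane q \<and>
      adapted_metric q (push_forward ?F E q) (push_forward ?F E q) = 1"
    using ns
    by (auto simp: tangent_space_motion[OF ab] contact_plane_motion[OF ab] nonsingular_surface_def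
        push_forward_motion_image[OF ab] adapted_metric_motion[OF ab])
  ultimately have "nonsingular_surface (?F ` S) (push_forward ?F E)"
    by (simp add: nonsingular_surface_def)
  moreover have "\<forall>q\<in>?F ` S. has_p_mean_curvature (?F ` S) (push_forward ?F E) q (2 * r)"
  proof
    fix q assume "q \<in> ?F ` S"
    then obtain p where p: "p \<in> S" "q = ?F p" by blast
    then have "has_nabla S (e2_field E) p (E p) (- (2 * r) *\<^sub>R E p)"
      using S by (simp add: cpmc_surface_def has_p_mean_curvature_def)
    from has_nabla_motion[OF ab this, of k l m]
    show "has_p_mean_curvature (?F ` S) (push_forward ?F E) q (2 * r)"
      unfolding has_p_mean_curvature_def p(2) e2_field_push_forward[OF ab] push_forward_motion_image[OF ab] L.scaleR .
  qed
  moreover have "\<forall>q\<in>?F ` S. alpha (?F ` S) (push_forward ?F E) q \<noteq> 0"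
    using S by (auto simp: alpha_motion[OF ab] cpmc_surface_def)
  ultimately show ?thesis
    by (simp add: cpmc_surface_def)
qed

text \<open>The composed chart keeps its domain, and both tangent fields are carried along with
  their expansions. So the coefficients a and b stay the same functions of the coordinates.\<close>

lemma normal_coords_motion:
  assumes ab: "a\<^sup>2 + b\<^sup>2 = 1" and X: "normal_coords r S E U X c1 c2"
  shows "normal_coords r (motion a b k l m ` S) (push_forward (motion a b k l m) E) U
    (motion a b k l m \<circ> X) c1 c2"
proof -
  interpret L: bounded_linear "motion_deriv a b k l" by (rule bounded_linear_motion_deriv)
  have lp: "local_param S U X"
    using X by (simp add: normal_coords_def compatible_coords_def)
  have "frechet_derivative (\<lambda>u. motion a b k l m (X u)) (at u) v =
      motion_deriv a b k l (frechet_derivative X (at u) v)" if "u \<in> U" for u v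
    using lp smooth_on_has_derivative[OF _ that, of X]
    by (simp add: local_param_def frechet_derivative_eqI[OF has_derivative_motion_compose])
  then show ?thesis
    using X local_param_motion[OF ab lp, of k l m]
    unfolding normal_coords_def compatible_coords_def comp_def alpha_motion[OF ab] e2_hat_motion[OF ab]
      push_forward_motion_image[OF ab]
    by (simp add: L.add[symmetric] L.scaleR[symmetric])
qed

lemma rigid_motion_invariance:
  assumes "heis_rigid_motion F" "cpmc_surface r S E" "normal_coords r S E U X c1 c2"
  shows "cpmc_surface r (F ` S) (push_forward F E)"
    "normal_coords r (F ` S) (push_forward F E) U (F \<circ> X) c1 c2"
  using heis_rigid_motion_imp_motion[OF assms(1)] cpmc_surface_motion[OF _ assms(2)]
    normal_coords_motion[OF _ assms(3)] by metis+

section \<open>Normal coordinates\<close>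

text \<open>In the frame, \<open>J\<close> turns the coefficients of \<open>E\<close> by a right
  angle. The curvature equation thus says that the angle of \<open>E\<close> turns at rate
  \<open>h\<close> along a curve with velocity \<open>E p\<close>.\<close>

lemma curvature_along_curve:
  assumes "has_p_mean_curvature S E p h" "curve_in S p (E p) \<gamma>"
  shows "((\<lambda>t. fst (E (\<gamma> t))) has_real_derivative - h * fst (snd (E p))) (at 0)"
    and "((\<lambda>t. fst (snd (E (\<gamma> t)))) has_real_derivative h * fst (E p)) (at 0)"
proof -
  have "((\<lambda>t. frame_coords (\<gamma> t) (J (\<gamma> t) (E (\<gamma> t)))) has_vector_derivative
      frame_coords p (- h *\<^sub>R E p)) (at 0)"
    using assms by (simp add: has_p_mean_curvature_def has_nabla_def)
  then have v: "((\<lambda>t. (- fst (snd (E (\<gamma> t))), fst (E (\<gamma> t)), 0::real)) has_vector_derivative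
      frame_coords p (- h *\<^sub>R E p)) (at 0)"
    by (simp add: frame_coords_J)
  from bounded_linear.has_vector_derivative[OF bounded_linear_fst_comp[OF bounded_linear_snd] v]
  show "((\<lambda>t. fst (E (\<gamma> t))) has_real_derivative - h * fst (snd (E p))) (at 0)"
    by (simp add: has_real_derivative_iff_has_vector_derivative frame_coords_def)
  from bounded_linear.has_vector_derivative[OF bounded_linear_minus[OF bounded_linear_fst] v]
  show "((\<lambda>t. fst (snd (E (\<gamma> t)))) has_real_derivative h * fst (E p)) (at 0)"
    by (simp add: has_real_derivative_iff_has_vector_derivative frame_coords_def)
qed

lemma curve_in_local_param:
  assumes X: "local_param S U X" and "u \<in> U"
  shows "curve_in S (X u) (frechet_derivative X (at u) v) (\<lambda>t. X (u + t *\<^sub>R v))"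
proof -
  have U: "open U" "smooth_on U X" "X ` U \<subseteq> S"
    using X unfolding local_param_def by (auto dest: openin_imp_subset)
  have "open ((\<lambda>t. u + t *\<^sub>R v) -` U)"
    by (intro continuous_open_vimage continuous_intros U)
  then obtain r where r: "r > 0" "ball 0 r \<subseteq> (\<lambda>t. u + t *\<^sub>R v) -` U"
    using \<open>u \<in> U\<close> openE[of "(\<lambda>t. u + t *\<^sub>R v) -` U" 0] by auto
  then have rU: "u + t *\<^sub>R v \<in> U" if "t \<in> {-r<..<r}" for t
    using that by (auto simp: subset_iff dist_real_def)
  have "smooth_on {-r<..<r} (\<lambda>t. X (u + t *\<^sub>R v))"
    by (rule smooth_on_compose_affine[OF _ bounded_linear_scaleR_left rU U(2)]) auto
  moreover have "((\<lambda>t. X (u + t *\<^sub>R v)) has_vector_derivative frechet_derivative X (at u) v) (at 0)"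
    by (rule has_derivative_along_line) (simp add: smooth_on_has_derivative[OF U(2) \<open>u \<in> U\<close>])
  ultimately show ?thesis
    unfolding curve_in_def using r(1) rU U(3) by (intro conjI exI[of _ r]) auto
qed

lemma linear_prod2:
  fixes g :: "real \<times> real \<Rightarrow> 'b::real_vector"
  assumes "linear g"
  shows "g v = fst v *\<^sub>R g (1, 0) + snd v *\<^sub>R g (0, 1)"
proof -
  have "g v = g (fst v *\<^sub>R (1, 0) + snd v *\<^sub>R (0, 1))"
    by (cases v) simp
  then show ?thesis
    by (simp only: linear_add[OF assms] linear_scale[OF assms])
qed

lemma frame_coords_add: "frame_coords p (v + w) = frame_coords p v + frame_coords p w"
  and frame_coords_scaleR: "frame_coords p (c *\<^sub>R v) = c *\<^sub>R frame_coords p v"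
  by (cases p; cases v; cases w; simp add: frame_coords_def contact_form_def algebra_simps)+

locale normal_chart =
  fixes lam :: real and S E U X c1 c2
  assumes lam: "lam > 0"
    and cpmc: "cpmc_surface lam S E"
    and normal: "normal_coords lam S E U X c1 c2"
begin

definition "Xx u = frechet_derivative X (at u) (1, 0)"
definition "Xy u = frechet_derivative X (at u) (0, 1)"
definition "P u = fst (Xx u)"
definition "Q u = fst (snd (Xx u))"
definition "phase u = 2 * lam * fst u + c1 (snd u)"
definition "D u = c2 (snd u) - cos (phase u)"
text \<open>Up to the factor 1 / sqrt(1 + alpha^2), this is the second unit tangent minus its
  \<open>E\<close> part with the coefficient a of normal coordinates. It is therefore a multiple of
  \<open>Xy u\<close>; the same square root occurs in b and cancels.\<close>

definition "N u = alpha S E (X u) *\<^sub>R J (X u) (E (X u)) + reeb (X u) + lam *\<^sub>R E (X u)"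

text \<open>The differential of the angle of E in the coordinates.\<close>

definition "turning u v = 2 * lam * fst v + sgn (D u) * c2 (snd u) * snd v"

lemma local_param: "local_param S U X"
  using normal by (simp add: normal_coords_def compatible_coords_def)

lemma open_U: "open U" and smooth_X: "smooth_on U X" and X_in: "u \<in> U \<Longrightarrow> X u \<in> S"
  using local_param unfolding local_param_def by (auto dest: openin_imp_subset)

lemma X_derivative: "u \<in> U \<Longrightarrow> (X has_derivative frechet_derivative X (at u)) (at u)"
  by (rule smooth_on_has_derivative[OF smooth_X])

lemma X_derivative_eq:
  assumes "u \<in> U"
  shows "frechet_derivative X (at u) v = fst v *\<^sub>R Xx u + snd v *\<^sub>R Xy u"
  unfolding Xx_def Xy_def
  by (rule linear_prod2) (rule has_derivative_linear[OF X_derivative[OF assms]])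

lemma E_X: "u \<in> U \<Longrightarrow> E (X u) = Xx u"
  using normal unfolding normal_coords_def compatible_coords_def by (simp add: Xx_def)

lemma D_nonzero: "u \<in> U \<Longrightarrow> D u \<noteq> 0"
  and alpha_eq: "u \<in> U \<Longrightarrow> alpha S E (X u) = lam * (sin (phase u) / D u)"
  using normal unfolding normal_coords_def D_def phase_def by (cases u; force)+

lemma contact_Xx: "u \<in> U \<Longrightarrow> contact_form (X u) (Xx u) = 0"
  and unit_Xx: "u \<in> U \<Longrightarrow> (P u)\<^sup>2 + (Q u)\<^sup>2 = 1"
proof -
  assume u: "u \<in> U"
  have *: "E (X u) \<in> contact_plane (X u)" "adapted_metric (X u) (E (X u)) (E (X u)) = 1"
    using cpmc X_in[OF u] unfolding cpmc_surface_def nonsingular_surface_def by auto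
  from *(1) show "contact_form (X u) (Xx u) = 0"
    by (simp add: E_X[OF u] contact_plane_def)
  with *(2) show "(P u)\<^sup>2 + (Q u)\<^sup>2 = 1"
    by (simp add: E_X[OF u] adapted_metric_def frame_coords_def P_def Q_def power2_eq_square)
qed

lemma Xy_eq:
  assumes u: "u \<in> U"
  shows "Xy u = (\<bar>D u\<bar> / (2 * lam\<^sup>2)) *\<^sub>R N u"
proof -
  let ?w = "sqrt (1 + (alpha S E (X u))\<^sup>2)"
  have w: "?w > 0"
    by (simp add: add_pos_nonneg)
  have "e2_hat S E (X u) = (- lam / ?w) *\<^sub>R Xx u + (2 * lam\<^sup>2 / (\<bar>D u\<bar> * ?w)) *\<^sub>R Xy u"
    using normal u unfolding normal_coords_def compatible_coords_def Xx_def Xy_def D_def phase_def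
    by (cases u) auto
  then have "(1 / ?w) *\<^sub>R N u = (2 * lam\<^sup>2 / (\<bar>D u\<bar> * ?w)) *\<^sub>R Xy u"
    unfolding e2_hat_def N_def E_X[OF u] by (simp add: scaleR_add_right)
  then have "(\<bar>D u\<bar> * ?w / (2 * lam\<^sup>2)) *\<^sub>R (1 / ?w) *\<^sub>R N u =
      (\<bar>D u\<bar> * ?w / (2 * lam\<^sup>2)) *\<^sub>R (2 * lam\<^sup>2 / (\<bar>D u\<bar> * ?w)) *\<^sub>R Xy u"
    by simp
  then show ?thesis
    using w D_nonzero[OF u] lam by simp
qed

lemma frame_coords_Xx: "u \<in> U \<Longrightarrow> frame_coords (X u) (Xx u) = (P u, Q u, 0)"
  by (simp add: frame_coords_def contact_Xx P_def Q_def)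

text \<open>The denominator of \<open>alpha\<close> cancels against the factor
  \<open>\<bar>D u\<bar>\<close> of \<open>Xy_eq\<close>. What remains is differentiable apart from
  \<open>sgn (D u)\<close>, which is locally constant.\<close>

lemma frame_coords_Xy:
  assumes u: "u \<in> U"
  shows "frame_coords (X u) (Xy u) = (sgn (D u) / (2 * lam)) *\<^sub>R
    (D u * P u - sin (phase u) * Q u, D u * Q u + sin (phase u) * P u, D u / lam)"
proof -
  have "frame_coords (X u) (reeb (X u)) = (0, 0, 1)"
    by (simp add: frame_coords_def reeb_def contact_form_def split: prod.splits)
  then show ?thesis
    using D_nonzero[OF u] lam
    unfolding Xy_eq[OF u] N_def E_X[OF u] frame_coords_add frame_coords_scaleR frame_coords_J
      alpha_eq[OF u] frame_coords_Xx[OF u] abs_sgn[of "D u"]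
    by (simp add: P_def[symmetric] Q_def[symmetric] field_simps power2_eq_square)
qed

lemma frame_coords_X_derivative:
  assumes "u \<in> U"
  shows "frame_coords (X u) (frechet_derivative X (at u) v) = fst v *\<^sub>R (P u, Q u, 0) +
    (snd v * sgn (D u) / (2 * lam)) *\<^sub>R
    (D u * P u - sin (phase u) * Q u, D u * Q u + sin (phase u) * P u, D u / lam)"
  unfolding X_derivative_eq[OF assms] frame_coords_add frame_coords_scaleR
    frame_coords_Xx[OF assms] frame_coords_Xy[OF assms]
  by simp

lemma smooth_P: "smooth_on U P" and smooth_Q: "smooth_on U Q"
  unfolding P_def Q_def Xx_def
  by (rule smooth_on_linear[OF open_U _ smooth_on_frechet_derivative[OF smooth_X]],
      simp add: bounded_linear_fst bounded_linear_fst_comp bounded_linear_snd)+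

text \<open>The lines y = const are mapped to integral curves of \<open>E\<close>, so the rate at
  which \<open>E\<close> turns along them is the curvature.\<close>

lemma P_derivative_x: "u \<in> U \<Longrightarrow> frechet_derivative P (at u) (1, 0) = - 2 * lam * Q u"
  and Q_derivative_x: "u \<in> U \<Longrightarrow> frechet_derivative Q (at u) (1, 0) = 2 * lam * P u"
proof -
  assume u: "u \<in> U"
  let ?\<gamma> = "\<lambda>t. X (u + t *\<^sub>R (1, 0))"
  have "has_p_mean_curvature S E (X u) (2 * lam)"
    using cpmc X_in[OF u] by (simp add: cpmc_surface_def)
  note * = curvature_along_curve[OF this, of ?\<gamma>]
  have "curve_in S (X u) (E (X u)) ?\<gamma>"
    using curve_in_local_param[OF local_param u, of "(1, 0)"] by (simp add: E_X[OF u] Xx_def)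
  note * = *[OF this]
  \<comment> \<open>\<open>E\<close> agrees with the partial derivative of \<open>X\<close> only
    over \<open>U\<close>, so the two functions of t are compared on this neighbourhood of
    0.\<close>
  have op: "open ((\<lambda>t. u + t *\<^sub>R (1, 0)) -` U)"
    by (intro continuous_open_vimage continuous_intros open_U)
  have "((\<lambda>t. P (u + t *\<^sub>R (1, 0))) has_real_derivative - (2 * lam) * Q u) (at 0)"
    using has_field_derivative_transform_within_open[OF *(1) op, of "\<lambda>t. P (u + t *\<^sub>R (1, 0))"] u
    by (simp add: E_X P_def Q_def zero_prod_def[symmetric])
  moreover have "((\<lambda>t. P (u + t *\<^sub>R (1, 0))) has_vector_derivative frechet_derivative P (at u) (1, 0)) (at 0)"
    by (rule has_derivative_along_line)
      (simp add: smooth_on_has_derivative[OF smooth_P u] zero_prod_def[symmetric])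
  ultimately show "frechet_derivative P (at u) (1, 0) = - 2 * lam * Q u"
    using vector_derivative_unique_at
    by (fastforce simp: has_real_derivative_iff_has_vector_derivative)
  have "((\<lambda>t. Q (u + t *\<^sub>R (1, 0))) has_real_derivative (2 * lam) * P u) (at 0)"
    using has_field_derivative_transform_within_open[OF *(2) op, of "\<lambda>t. Q (u + t *\<^sub>R (1, 0))"] u
    by (simp add: E_X P_def Q_def zero_prod_def[symmetric])
  moreover have "((\<lambda>t. Q (u + t *\<^sub>R (1, 0))) has_vector_derivative frechet_derivative Q (at u) (1, 0)) (at 0)"
    by (rule has_derivative_along_line)
      (simp add: smooth_on_has_derivative[OF smooth_Q u] zero_prod_def[symmetric])
  ultimately show "frechet_derivative Q (at u) (1, 0) = 2 * lam * P u"
    using vector_derivative_unique_at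
    by (fastforce simp: has_real_derivative_iff_has_vector_derivative)
qed

definition "dc1 u = frechet_derivative c1 (at (snd u))"
definition "dc2 u = frechet_derivative c2 (at (snd u))"

lemma phase_derivative:
  "u \<in> U \<Longrightarrow> (phase has_derivative (\<lambda>v. 2 * lam * fst v + dc1 u (snd v))) (at u)"
  and D_derivative:
  "u \<in> U \<Longrightarrow> (D has_derivative
      (\<lambda>v. dc2 u (snd v) + sin (phase u) * (2 * lam * fst v + dc1 u (snd v)))) (at u)"
proof -
  assume u: "u \<in> U"
  have "smooth_on (snd ` U) c1" "smooth_on (snd ` U) c2"
    using normal by (auto simp: normal_coords_def)
  then have "(c1 has_derivative dc1 u) (at (snd u))" "(c2 has_derivative dc2 u) (at (snd u))"
    using u by (auto simp: dc1_def dc2_def intro: smooth_on_has_derivative)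
  then have c: "((\<lambda>u. c1 (snd u)) has_derivative (\<lambda>v. dc1 u (snd v))) (at u)"
      "((\<lambda>u. c2 (snd u)) has_derivative (\<lambda>v. dc2 u (snd v))) (at u)"
    using has_derivative_compose[OF has_derivative_snd[OF has_derivative_ident]] by blast+
  show ph: "(phase has_derivative (\<lambda>v. 2 * lam * fst v + dc1 u (snd v))) (at u)"
    unfolding phase_def[abs_def] by (auto intro!: derivative_eq_intros c)
  show "(D has_derivative
      (\<lambda>v. dc2 u (snd v) + sin (phase u) * (2 * lam * fst v + dc1 u (snd v)))) (at u)"
    unfolding D_def[abs_def] by (auto intro!: derivative_eq_intros c ph)
qed

lemma dc_zero: "u \<in> U \<Longrightarrow> dc1 u 0 = 0" "u \<in> U \<Longrightarrow> dc2 u 0 = 0"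
  using linear_0[OF has_derivative_linear[OF phase_derivative]]
    linear_0[OF has_derivative_linear[OF D_derivative]] by fastforce+

text \<open>The formula for the y derivative of \<open>X\<close> has to be differentiated once more;
  on such a neighbourhood its factor \<open>sgn (D w)\<close> is a constant.\<close>

lemma sgn_D_eventually:
  assumes u: "u \<in> U"
  obtains B where "open B" "u \<in> B" "B \<subseteq> U" "\<And>w. w \<in> B \<Longrightarrow> sgn (D w) = sgn (D u)"
proof -
  have cont: "continuous_on U D"
    using D_derivative has_derivative_continuous continuous_on_eq_continuous_at[OF open_U] by blast
  have "open (U \<inter> (\<lambda>w. D w * D u) -` {0<..})"
    by (intro continuous_open_preimage continuous_intros cont open_U)
  moreover have "u \<in> U \<inter> (\<lambda>w. D w * D u) -` {0<..}"
    using u D_nonzero[OF u] by (auto simp: zero_less_mult_iff)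
  moreover have "sgn (D w) = sgn (D u)" if "w \<in> U \<inter> (\<lambda>w. D w * D u) -` {0<..}" for w
    using that by (auto simp: zero_less_mult_iff sgn_if)
  ultimately show thesis
    using that by blast
qed

text \<open>Integrability: equality of the mixed second derivatives of the first two components of X.\<close>

lemma P_derivative: "u \<in> U \<Longrightarrow> (P has_derivative (\<lambda>v. - turning u v * Q u)) (at u)"
  and Q_derivative: "u \<in> U \<Longrightarrow> (Q has_derivative (\<lambda>v. turning u v * P u)) (at u)"
proof -
  assume u: "u \<in> U"
  have sm: "smooth_on U (\<lambda>u. fst (X u))" "smooth_on U (\<lambda>u. fst (snd (X u)))"
    by (rule smooth_on_linear[OF open_U _ smooth_X],
        simp add: bounded_linear_fst bounded_linear_fst_comp bounded_linear_snd)+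
  have fX: "frechet_derivative (\<lambda>u. fst (X u)) (at w) v = fst (frechet_derivative X (at w) v)"
    "frechet_derivative (\<lambda>u. fst (snd (X u))) (at w) v = fst (snd (frechet_derivative X (at w) v))"
    if "w \<in> U" for w v
    using that by (subst frechet_derivative_eqI; auto intro!: derivative_eq_intros X_derivative)+
  \<comment> \<open>The first two frame coefficients are the ordinary components, so the frame
    formulas can be read as partial derivatives of two real functions.\<close>
  have fr: "fst (frechet_derivative X (at w) v) = fst (frame_coords (X w) (frechet_derivative X (at w) v))"
    "fst (snd (frechet_derivative X (at w) v)) = fst (snd (frame_coords (X w) (frechet_derivative X (at w) v)))" for w v
    by (simp_all add: frame_coords_def)
  obtain B where B: "open B" "u \<in> B" "B \<subseteq> U" "\<And>w. w \<in> B \<Longrightarrow> sgn (D w) = sgn (D u)"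
    using sgn_D_eventually[OF u] by blast
  define k where "k = sgn (D u) / (2 * lam)"
  define DP where "DP = frechet_derivative P (at u)"
  define DQ where "DQ = frechet_derivative Q (at u)"
  have dP: "(P has_derivative DP) (at u)" and dQ: "(Q has_derivative DQ) (at u)"
    using smooth_P smooth_Q u by (auto simp: DP_def DQ_def intro: smooth_on_has_derivative)
  have x: "DP (1, 0) = - 2 * lam * Q u" "DQ (1, 0) = 2 * lam * P u"
    using u by (simp_all add: DP_def DQ_def P_derivative_x Q_derivative_x)
  have c2: "D u + cos (phase u) = c2 (snd u)"
    by (simp add: D_def)
  have "DP (0, 1) = frechet_derivative (\<lambda>w. frechet_derivative (\<lambda>u. fst (X u)) (at w) (1, 0)) (at u) (0, 1)"
  proof -
    have "((\<lambda>w. frechet_derivative (\<lambda>u. fst (X u)) (at w) (1, 0)) has_derivative DP) (at u)"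
      by (rule has_derivative_transform_within_open[OF dP open_U u]) (simp add: fX P_def Xx_def)
    then show ?thesis by (simp add: frechet_derivative_eqI)
  qed
  also have "\<dots> = frechet_derivative (\<lambda>w. frechet_derivative (\<lambda>u. fst (X u)) (at w) (0, 1)) (at u) (1, 0)"
    by (rule symmetric_second_derivative[OF sm(1) open_U u])
  also have "\<dots> = - sgn (D u) * c2 (snd u) * Q u"
  proof -
    have eq: "k * (D w * P w - sin (phase w) * Q w) = frechet_derivative (\<lambda>u. fst (X u)) (at w) (0, 1)" if "w \<in> B" for w
    proof -
      have w: "w \<in> U" "sgn (D w) = sgn (D u)"
        using B(3,4) that by auto
      show ?thesis
        by (simp add: k_def fX(1,2)[OF w(1)] fr frame_coords_X_derivative[OF w(1)] w(2))
    qed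
    have "((\<lambda>w. k * (D w * P w - sin (phase w) * Q w)) has_derivative
       (\<lambda>v. k * ((D u * DP v + (dc2 u (snd v) + sin (phase u) * (2 * lam * fst v + dc1 u (snd v))) * P u)
         - (sin (phase u) * DQ v + (cos (phase u) * (2 * lam * fst v + dc1 u (snd v))) * Q u)))) (at u)"
      by (auto intro!: derivative_eq_intros dP dQ D_derivative phase_derivative u)
    then have "((\<lambda>w. frechet_derivative (\<lambda>u. fst (X u)) (at w) (0, 1)) has_derivative
       (\<lambda>v. k * ((D u * DP v + (dc2 u (snd v) + sin (phase u) * (2 * lam * fst v + dc1 u (snd v))) * P u)
         - (sin (phase u) * DQ v + (cos (phase u) * (2 * lam * fst v + dc1 u (snd v))) * Q u)))) (at u)"
      by (rule has_derivative_transform_within_open[OF _ B(1,2) eq])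
    then have "frechet_derivative (\<lambda>w. frechet_derivative (\<lambda>u. fst (X u)) (at w) (0, 1)) (at u) (1, 0) =
       k * ((D u * DP (1, 0) + sin (phase u) * (2 * lam) * P u)
         - (sin (phase u) * DQ (1, 0) + cos (phase u) * (2 * lam) * Q u))"
      by (simp add: frechet_derivative_eqI dc_zero[OF u])
    \<comment> \<open>In direction (1, 0) the derivatives of \<open>c1\<close> and \<open>c2\<close>
      vanish, and after inserting \<open>x\<close> the two sine terms cancel. The remaining
      \<open>D u + cos (phase u)\<close> is \<open>c2 (snd u)\<close>, which is how
      \<open>c2\<close> becomes the rate of turning in y.\<close>
    also have "\<dots> = - sgn (D u) * (D u + cos (phase u)) * Q u"
      unfolding x k_def using lam by (simp add: field_simps)
    finally show ?thesis unfolding c2 .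
  qed
  finally have y: "DP (0, 1) = - sgn (D u) * c2 (snd u) * Q u" .
  have "DQ (0, 1) = frechet_derivative (\<lambda>w. frechet_derivative (\<lambda>u. fst (snd (X u))) (at w) (1, 0)) (at u) (0, 1)"
  proof -
    have "((\<lambda>w. frechet_derivative (\<lambda>u. fst (snd (X u))) (at w) (1, 0)) has_derivative DQ) (at u)"
      by (rule has_derivative_transform_within_open[OF dQ open_U u]) (simp add: fX Q_def Xx_def)
    then show ?thesis by (simp add: frechet_derivative_eqI)
  qed
  also have "\<dots> = frechet_derivative (\<lambda>w. frechet_derivative (\<lambda>u. fst (snd (X u))) (at w) (0, 1)) (at u) (1, 0)"
    by (rule symmetric_second_derivative[OF sm(2) open_U u])
  also have "\<dots> = sgn (D u) * c2 (snd u) * P u"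
  proof -
    have eq: "k * (D w * Q w + sin (phase w) * P w) = frechet_derivative (\<lambda>u. fst (snd (X u))) (at w) (0, 1)" if "w \<in> B" for w
    proof -
      have w: "w \<in> U" "sgn (D w) = sgn (D u)"
        using B(3,4) that by auto
      show ?thesis
        by (simp add: k_def fX(1,2)[OF w(1)] fr frame_coords_X_derivative[OF w(1)] w(2))
    qed
    have "((\<lambda>w. k * (D w * Q w + sin (phase w) * P w)) has_derivative
       (\<lambda>v. k * ((D u * DQ v + (dc2 u (snd v) + sin (phase u) * (2 * lam * fst v + dc1 u (snd v))) * Q u)
         + (sin (phase u) * DP v + (cos (phase u) * (2 * lam * fst v + dc1 u (snd v))) * P u)))) (at u)"
      by (auto intro!: derivative_eq_intros dP dQ D_derivative phase_derivative u)
    then have "((\<lambda>w. frechet_derivative (\<lambda>u. fst (snd (X u))) (at w) (0, 1)) has_derivative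
       (\<lambda>v. k * ((D u * DQ v + (dc2 u (snd v) + sin (phase u) * (2 * lam * fst v + dc1 u (snd v))) * Q u)
         + (sin (phase u) * DP v + (cos (phase u) * (2 * lam * fst v + dc1 u (snd v))) * P u)))) (at u)"
      by (rule has_derivative_transform_within_open[OF _ B(1,2) eq])
    then have "frechet_derivative (\<lambda>w. frechet_derivative (\<lambda>u. fst (snd (X u))) (at w) (0, 1)) (at u) (1, 0) =
       k * ((D u * DQ (1, 0) + sin (phase u) * (2 * lam) * Q u)
         + (sin (phase u) * DP (1, 0) + cos (phase u) * (2 * lam) * P u))"
      by (simp add: frechet_derivative_eqI dc_zero[OF u])
    also have "\<dots> = sgn (D u) * (D u + cos (phase u)) * P u"
      unfolding x k_def using lam by (simp add: field_simps)
    finally show ?thesis unfolding c2 .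
  qed
  finally have y': "DQ (0, 1) = sgn (D u) * c2 (snd u) * P u" .
  have "DP = (\<lambda>v. - turning u v * Q u)"
  proof
    fix v
    have "DP v = fst v * DP (1, 0) + snd v * DP (0, 1)"
      using linear_prod2[OF has_derivative_linear[OF dP], of v] by simp
    then show "DP v = - turning u v * Q u"
      unfolding x y turning_def by (simp add: algebra_simps)
  qed
  with dP show "(P has_derivative (\<lambda>v. - turning u v * Q u)) (at u)" by simp
  have "DQ = (\<lambda>v. turning u v * P u)"
  proof
    fix v
    have "DQ v = fst v * DQ (1, 0) + snd v * DQ (0, 1)"
      using linear_prod2[OF has_derivative_linear[OF dQ], of v] by simp
    then show "DQ v = turning u v * P u"
      unfolding x y' turning_def by (simp add: algebra_simps)
  qed
  with dQ show "(Q has_derivative (\<lambda>v. turning u v * P u)) (at u)" by simp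
qed

end

section \<open>Local congruence\<close>

text \<open>The first two coefficients are ordinary components and give equality there by
  integration. Only when these components agree do equal values of the contact form, taken at two a
  priori different points, give equal third derivatives.\<close>

lemma eq_if_frame_coords_derivative_eq:
  fixes Y Z :: "'a::real_normed_vector \<Rightarrow> heis"
  assumes "convex B" "u \<in> B" "w \<in> B" and u: "Y u = Z u"
    and Y: "\<And>w. w \<in> B \<Longrightarrow> (Y has_derivative Y' w) (at w)"
    and Z: "\<And>w. w \<in> B \<Longrightarrow> (Z has_derivative Z' w) (at w)"
    and eq: "\<And>w v. w \<in> B \<Longrightarrow> frame_coords (Y w) (Y' w v) = frame_coords (Z w) (Z' w v)"
  shows "Y w = Z w"
proof -
  have const: "f (Y w) = f (Z w)"
    if f: "bounded_linear f" and "\<And>w v. w \<in> B \<Longrightarrow> f (Y' w v) = f (Z' w v)" "w \<in> B"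
    for f :: "heis \<Rightarrow> real" and w
  proof -
    have "((\<lambda>w. f (Y w) - f (Z w)) has_derivative (\<lambda>v. f (Y' w v) - f (Z' w v))) (at w within B)"
      if "w \<in> B" for w
      by (intro has_derivative_diff bounded_linear.has_derivative[OF f]
          has_derivative_at_withinI[OF Y[OF that]] has_derivative_at_withinI[OF Z[OF that]])
    then have "((\<lambda>w. f (Y w) - f (Z w)) has_derivative (\<lambda>v. 0)) (at w within B)" if "w \<in> B" for w
      using that \<open>\<And>w v. w \<in> B \<Longrightarrow> f (Y' w v) = f (Z' w v)\<close> by simp
    then obtain c where c: "\<And>w. w \<in> B \<Longrightarrow> f (Y w) - f (Z w) = c"
      using has_derivative_zero_constant[OF \<open>convex B\<close>, of "\<lambda>w. f (Y w) - f (Z w)"] by blast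
    show ?thesis
      using c[OF \<open>u \<in> B\<close>] c[OF \<open>w \<in> B\<close>] by (simp add: u)
  qed
  have eqs: "fst (Y' w v) = fst (Z' w v)" "fst (snd (Y' w v)) = fst (snd (Z' w v))"
    "contact_form (Y w) (Y' w v) = contact_form (Z w) (Z' w v)" if "w \<in> B" for w v
    using eq[OF that] by (auto simp: frame_coords_def)
  have 1: "fst (Y w) = fst (Z w)" if "w \<in> B" for w
    by (rule const[OF bounded_linear_fst _ that]) (rule eqs)
  have 2: "fst (snd (Y w)) = fst (snd (Z w))" if "w \<in> B" for w
    by (rule const[OF bounded_linear_fst_comp[OF bounded_linear_snd] _ that]) (rule eqs)
  have "snd (snd (Y' w v)) = snd (snd (Z' w v))" if "w \<in> B" for w v
    using eqs[OF that, of v] 1[OF that] 2[OF that] by (simp add: contact_form_def case_prod_beta)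
  then have 3: "snd (snd (Y w)) = snd (snd (Z w))"
    by (intro const[OF bounded_linear_snd_comp[OF bounded_linear_snd] _ \<open>w \<in> B\<close>])
  show ?thesis
    using 1[OF \<open>w \<in> B\<close>] 2[OF \<open>w \<in> B\<close>] 3 by (simp add: prod_eq_iff)
qed

text \<open>\<open>A\<close> and its image are cut out of the two surfaces by open sets; the
  neighbourhood wanted is the first of these intersected with the preimage of the second.\<close>

lemma locally_congruent_atI:
  assumes F: "heis_rigid_motion F" "F p = p'" and p: "p \<in> A"
    and A: "openin (top_of_set S) A" "openin (top_of_set S') (F ` A)"
  shows "locally_congruent_at S p S' p'"
proof -
  obtain V where V: "open V" "A = S \<inter> V"
    using A(1) by (auto simp: openin_open)
  obtain V' where V': "open V'" "F ` A = S' \<inter> V'"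
    using A(2) by (auto simp: openin_open)
  have "continuous_on UNIV F"
    using F(1) by (simp add: heis_rigid_motion_def smooth_on_imp_continuous_on)
  then have "open (V \<inter> F -` V')"
    using V(1) V'(1) by (intro open_Int open_vimage)
  moreover have "p \<in> V \<inter> F -` V'"
    using p V(2) V'(2) by auto
  moreover have "F ` (S \<inter> (V \<inter> F -` V')) = S' \<inter> F ` (V \<inter> F -` V')"
    using V(2) V'(2) by blast
  ultimately show ?thesis
    using F unfolding locally_congruent_at_def by blast
qed

lemma local_param_openin_image:
  assumes "local_param S U X" "open B" "B \<subseteq> U"
  shows "openin (top_of_set S) (X ` B)"
proof -
  obtain g where g: "homeomorphism U (X ` U) X g" and o: "openin (top_of_set S) (X ` U)"
    using assms(1) unfolding local_param_def by blast
  have "openin (top_of_set U) B"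
    using assms(2,3) by (simp add: openin_open_eq open_subset)
  then have "openin (top_of_set (X ` U)) (X ` B)"
    by (rule homeomorphism_imp_open_map[OF g])
  then show ?thesis
    using o by (rule openin_trans)
qed

lemma normal_charts_locally_congruent:
  assumes A: "normal_chart r S E U X c1 c2" and B: "normal_chart r S' E' U' X' c1' c2'"
    and agree: "agree_up_to t s d (snd ` U) c1 c2 (snd ` U') c1' c2'"
    and u: "u \<in> U" "u' \<in> U'" "snd u' = snd u + t" "phases_match r s c1 c1' u u'"
  shows "locally_congruent_at S (X u) S' (X' u')"
proof -
  interpret A: normal_chart r S E U X c1 c2 by (rule A)
  interpret B: normal_chart r S' E' U' X' c1' c2' by (rule B)
  \<comment> \<open>Corresponding points of the two domains differ by a translation: in y it is
    \<open>t\<close>, in x it is fixed by the pair \<open>u\<close>, \<open>u'\<close>.\<close>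
  define \<delta> where "\<delta> = u' - u"
  obtain e1 where e1: "e1 > 0" "ball u e1 \<subseteq> U"
    using A.open_U u(1) openE by blast
  obtain e2 where e2: "e2 > 0" "ball u' e2 \<subseteq> U'"
    using B.open_U u(2) openE by blast
  define W where "W = ball u (min e1 e2)"
  have W: "open W" "convex W" "u \<in> W"
    using e1 e2 by (auto simp: W_def)
  have WU: "w \<in> U" if "w \<in> W" for w
    using that e1 by (auto simp: W_def)
  have WU': "w + \<delta> \<in> U'" if "w \<in> W" for w
  proof -
    have "dist u' (w + \<delta>) = dist u w"
      by (simp add: \<delta>_def dist_norm algebra_simps)
    then show ?thesis
      using that e2 by (auto simp: W_def)
  qed
  have s: "s = 1 \<or> s = -1"
    using agree by (simp add: agree_up_to_def)
  have snd_\<delta>': "snd \<delta> = t"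
    using u(3) by (simp add: \<delta>_def)
  then have snd_\<delta>: "snd (w + \<delta>) = snd w + t" for w
    by simp
  have c12: "c2' (snd w + t) = s * c2 (snd w)" "c1' (snd w + t) = c1 (snd w) + d" if "w \<in> W" for w
    using agree WU[OF that] imageI[OF WU'[OF that], of snd] unfolding agree_up_to_def snd_\<delta> by auto
  \<comment> \<open>The phase difference of corresponding points, constant over \<open>W\<close>.
    The match at \<open>u\<close> alone thus makes it a multiple of pi with cosine \<open>s\<close>
    everywhere on \<open>W\<close>.\<close>
  define \<kappa> where "\<kappa> = 2 * r * fst \<delta> + d"
  have phase: "B.phase (w + \<delta>) = A.phase w + \<kappa>" if "w \<in> W" for w
    using c12[OF that] by (simp add: A.phase_def B.phase_def snd_\<delta>' \<kappa>_def algebra_simps)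
  have \<kappa>: "cos \<kappa> = s" "sin \<kappa> = 0"
  proof -
    have "u + \<delta> = u'" by (simp add: \<delta>_def)
    with phase[OF W(3)] have \<kappa>_eq: "\<kappa> = B.phase u' - A.phase u" by simp
    have "cis (B.phase u') = of_real s * cis (A.phase u)"
      using u(4) by (simp add: phases_match_def A.phase_def B.phase_def)
    then have *: "cos (B.phase u') = s * cos (A.phase u)" "sin (B.phase u') = s * sin (A.phase u)"
      by (auto simp: complex_eq_iff)
    have "cos \<kappa> = s * ((cos (A.phase u))\<^sup>2 + (sin (A.phase u))\<^sup>2)" "sin \<kappa> = 0"
      unfolding \<kappa>_eq cos_diff sin_diff * by algebra+
    then show "cos \<kappa> = s" "sin \<kappa> = 0" by simp_all
  qed
  have trig: "cos (B.phase (w + \<delta>)) = s * cos (A.phase w)" "sin (B.phase (w + \<delta>)) = s * sin (A.phase w)"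
    if "w \<in> W" for w
    unfolding phase[OF that] cos_add sin_add by (simp_all add: \<kappa>)
  have D: "B.D (w + \<delta>) = s * A.D w" if "w \<in> W" for w
    unfolding A.D_def B.D_def trig[OF that] snd_\<delta> c12[OF that] by (simp add: algebra_simps)
  \<comment> \<open>The sign \<open>s\<close> occurs twice, in \<open>sgn (D u)\<close> and in
    \<open>c2\<close>, and cancels.\<close>
  have turning: "B.turning (w + \<delta>) v = A.turning w v" if "w \<in> W" for w v
    unfolding A.turning_def B.turning_def D[OF that] snd_\<delta> c12[OF that]
    using s by (auto simp: sgn_mult)
  have shift: "((\<lambda>w. f (w + \<delta>)) has_derivative f') (at w)" if "(f has_derivative f') (at (w + \<delta>))"
    for f :: "real \<times> real \<Rightarrow> 'b::real_normed_vector" and f' w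
  proof -
    have "((\<lambda>w. w + \<delta>) has_derivative (\<lambda>v. v)) (at w)"
      by (auto intro!: derivative_eq_intros)
    from has_derivative_compose[OF this that] show ?thesis .
  qed
  define P' Q' where "P' = (\<lambda>w. B.P (w + \<delta>))" "Q' = (\<lambda>w. B.Q (w + \<delta>))"
  have dPQ: "(A.P has_derivative (\<lambda>v. - A.turning w v * A.Q w)) (at w)"
      "(A.Q has_derivative (\<lambda>v. A.turning w v * A.P w)) (at w)"
      "(P' has_derivative (\<lambda>v. - A.turning w v * Q' w)) (at w)"
      "(Q' has_derivative (\<lambda>v. A.turning w v * P' w)) (at w)" if "w \<in> W" for w
    using A.P_derivative[OF WU[OF that]] A.Q_derivative[OF WU[OF that]]
      shift[OF B.P_derivative[OF WU'[OF that]]] shift[OF B.Q_derivative[OF WU'[OF that]]]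
    by (simp_all add: turning[OF that] P'_Q'_def)
  have unit: "(A.P w)\<^sup>2 + (A.Q w)\<^sup>2 = 1" "(P' w)\<^sup>2 + (Q' w)\<^sup>2 = 1" if "w \<in> W" for w
    using A.unit_Xx[OF WU[OF that]] B.unit_Xx[OF WU'[OF that]] by (simp_all add: P'_Q'_def)
  \<comment> \<open>\<open>a\<close> and \<open>b\<close> are the cosine and sine of the angle from
    (P, Q) to (P', Q'); it is constant because both directions turn with the same
    differential.\<close>
  have "\<exists>a. \<forall>w\<in>W. A.P w * P' w + A.Q w * Q' w = a"
  proof (rule has_derivative_zero_constant[OF W(2)])
    fix w assume "w \<in> W"
    show "((\<lambda>w. A.P w * P' w + A.Q w * Q' w) has_derivative (\<lambda>h. 0)) (at w within W)"
      by (rule has_derivative_at_withinI)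
        (auto intro!: derivative_eq_intros dPQ[OF \<open>w \<in> W\<close>] simp: algebra_simps)
  qed
  then obtain a where a: "\<And>w. w \<in> W \<Longrightarrow> A.P w * P' w + A.Q w * Q' w = a" by blast
  have "\<exists>b. \<forall>w\<in>W. A.P w * Q' w - A.Q w * P' w = b"
  proof (rule has_derivative_zero_constant[OF W(2)])
    fix w assume "w \<in> W"
    show "((\<lambda>w. A.P w * Q' w - A.Q w * P' w) has_derivative (\<lambda>h. 0)) (at w within W)"
      by (rule has_derivative_at_withinI)
        (auto intro!: derivative_eq_intros dPQ[OF \<open>w \<in> W\<close>] simp: algebra_simps)
  qed
  then obtain b where b: "\<And>w. w \<in> W \<Longrightarrow> A.P w * Q' w - A.Q w * P' w = b" by blast
  have ab: "a\<^sup>2 + b\<^sup>2 = 1"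
  proof -
    have "a\<^sup>2 + b\<^sup>2 = ((A.P u)\<^sup>2 + (A.Q u)\<^sup>2) * ((P' u)\<^sup>2 + (Q' u)\<^sup>2)"
      unfolding a[OF W(3), symmetric] b[OF W(3), symmetric] by algebra
    then show ?thesis
      by (simp add: unit[OF W(3)])
  qed
  have rot: "P' w = a * A.P w - b * A.Q w" "Q' w = b * A.P w + a * A.Q w" if "w \<in> W" for w
  proof -
    have "a * A.P w - b * A.Q w = P' w * ((A.P w)\<^sup>2 + (A.Q w)\<^sup>2)"
         "b * A.P w + a * A.Q w = Q' w * ((A.P w)\<^sup>2 + (A.Q w)\<^sup>2)"
      unfolding a[OF that, symmetric] b[OF that, symmetric] by algebra+
    then show "P' w = a * A.P w - b * A.Q w" "Q' w = b * A.P w + a * A.Q w"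
      by (simp_all add: unit(1)[OF that])
  qed
  obtain k l m where F: "motion a b k l m (X u) = X' u'"
  proof -
    obtain x y z where p: "X u = (x, y, z)" by (cases "X u")
    obtain x' y' z' where p': "X' u' = (x', y', z')" by (cases "X' u'")
    \<comment> \<open>With the rotation fixed, the left translation is the one that carries the
      rotated \<open>X u\<close> to \<open>X' u'\<close>.\<close>
    define k l where "k = x' - (a * x - b * y)" "l = y' - (b * x + a * y)"
    show thesis
      by (rule that[of k l "z' - (z + (l * a - k * b) * x - (l * b + k * a) * y)"])
        (simp add: motion_def motion_deriv_def p p' k_l_def)
  qed
  let ?F = "motion a b k l m"
  have FX: "?F (X w) = X' (w + \<delta>)" if "w \<in> W" for w
  proof (rule eq_if_frame_coords_derivative_eq[OF W(2,3) that])
    show "?F (X u) = X' (u + \<delta>)"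
      by (simp add: F \<delta>_def)
    fix w v assume w: "w \<in> W"
    show "((\<lambda>w. ?F (X w)) has_derivative (\<lambda>v. motion_deriv a b k l (frechet_derivative X (at w) v))) (at w)"
      by (rule has_derivative_motion_compose[OF A.X_derivative[OF WU[OF w]]])
    show "((\<lambda>w. X' (w + \<delta>)) has_derivative frechet_derivative X' (at (w + \<delta>))) (at w)"
      by (rule shift[OF B.X_derivative[OF WU'[OF w]]])
    have PQ: "B.P (w + \<delta>) = a * A.P w - b * A.Q w" "B.Q (w + \<delta>) = b * A.P w + a * A.Q w"
      using rot[OF w] by (simp_all add: P'_Q'_def)
    \<comment> \<open>Both \<open>D\<close> and the sine are multiplied by \<open>s\<close>, so
      their products with the sign of \<open>D\<close> agree in the two charts. The rotation acts
      alike on (P, Q) and on (-Q, P).\<close>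
    show "frame_coords (?F (X w)) (motion_deriv a b k l (frechet_derivative X (at w) v)) =
        frame_coords (X' (w + \<delta>)) (frechet_derivative X' (at (w + \<delta>)) v)"
      unfolding frame_coords_motion[OF ab] A.frame_coords_X_derivative[OF WU[OF w]]
        B.frame_coords_X_derivative[OF WU'[OF w]] D[OF w] trig[OF w] PQ
      using s by (auto simp: motion_deriv_def algebra_simps)
  qed
  have "openin (top_of_set S) (X ` W)"
    by (rule local_param_openin_image[OF A.local_param W(1)]) (use WU in auto)
  moreover have "openin (top_of_set S') (X' ` (\<lambda>w. w + \<delta>) ` W)"
    by (rule local_param_openin_image[OF B.local_param])
      (use WU' W(1) open_translation[OF W(1), of \<delta>] in \<open>auto simp: add.commute\<close>)
  then have "openin (top_of_set S') (?F ` X ` W)"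
    using FX by (simp add: image_image cong: image_cong)
  ultimately show ?thesis
    using W(3) by (intro locally_congruent_atI[OF heis_rigid_motion_motion[OF ab] F]) auto
qed

section \<open>Uniqueness\<close>

text \<open>Let \<open>M\<close> be a linear left inverse of the injective derivative of
  \<open>X\<close> at the point. Then \<open>M\<close> after \<open>X\<close> has the identity as
  derivative there, and \<open>has_derivative_lift\<close> upgrades the continuous lift to a
  differentiable one.\<close>

lemma local_param_lift:
  fixes h :: "'b::real_normed_vector \<Rightarrow> heis"
  assumes X: "local_param S U X" and g: "homeomorphism U (X ` U) X g"
    and V: "open V" "z \<in> V" "h ` V \<subseteq> X ` U" "continuous_on V h"
    and h: "(h has_derivative h') (at z)"
  shows "\<exists>k. ((\<lambda>y. g (h y)) has_derivative k) (at z) \<and>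
    (\<forall>v. frechet_derivative X (at (g (h z))) (k v) = h' v)"
proof -
  let ?w = "g (h z)"
  let ?X' = "frechet_derivative X (at ?w)"
  have gX: "g (h y) \<in> U" "X (g (h y)) = h y" if "y \<in> V" for y
    using g V(3) that by (force simp: homeomorphism_def)+
  have X': "(X has_derivative ?X') (at ?w)" "inj ?X'"
    using X gX(1)[OF V(2)] unfolding local_param_def by (auto intro: smooth_on_has_derivative)
  then obtain M where M: "linear M" "M \<circ> ?X' = id"
    using linear_injective_left_inverse has_derivative_linear by blast
  then have M': "bounded_linear M" "M (?X' v) = v" for v
    using pointfree_idE[OF M(2)] by (simp_all add: linear_conv_bounded_linear)
  have "((\<lambda>x. M (X x)) has_derivative (\<lambda>v. v)) (at ?w)"
    using bounded_linear.has_derivative[OF M'(1) X'(1)] by (simp add: M'(2))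
  moreover have "isCont (\<lambda>y. g (h y)) z"
  proof -
    have "continuous_on V (\<lambda>y. g (h y))"
      by (rule continuous_on_compose2[OF homeomorphism_cont2[OF g] V(4,3)])
    then show ?thesis
      using V(2) by (simp add: continuous_on_eq_continuous_at[OF V(1)])
  qed
  moreover have "((\<lambda>y. M (X (g (h y)))) has_derivative (\<lambda>v. M (h' v))) (at z)"
    by (rule has_derivative_transform_within_open[OF bounded_linear.has_derivative[OF M'(1) h] V(1,2)])
      (simp add: gX)
  ultimately have k: "((\<lambda>y. g (h y)) has_derivative (\<lambda>v. M (h' v))) (at z)"
    by (rule has_derivative_lift)
  have "((\<lambda>y. X (g (h y))) has_derivative (\<lambda>v. ?X' (M (h' v)))) (at z)"
    by (rule has_derivative_compose[OF k X'(1)])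
  then have "(h has_derivative (\<lambda>v. ?X' (M (h' v)))) (at z)"
    by (rule has_derivative_transform_within_open[OF _ V(1,2)]) (simp add: gX)
  from has_derivative_unique[OF this h] k show ?thesis
    by (metis (no_types, lifting))
qed

text \<open>The set \<open>C\<close> need not be open or convex. On balls inside \<open>V\<close>
  the function is constant, hence it is locally constant on \<open>C\<close>, and connectedness does
  the rest.\<close>

lemma constant_on_connected_subset:
  fixes f :: "'a::real_normed_vector \<Rightarrow> 'b::real_normed_vector"
  assumes "open V" "C \<subseteq> V" "connected C" "x \<in> C" "y \<in> C"
    and f: "\<And>w. w \<in> V \<Longrightarrow> (f has_derivative (\<lambda>v. 0)) (at w)"
  shows "f x = f y"
proof (rule connected_local_const[OF assms(3,4,5)], rule ballI)
  fix a assume "a \<in> C"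
  then obtain e where e: "e > 0" "ball a e \<subseteq> V"
    using assms(1,2) openE by blast
  have "\<exists>c. \<forall>w\<in>ball a e. f w = c"
    by (rule has_derivative_zero_constant[OF convex_ball])
      (use e f in \<open>blast intro: has_derivative_at_withinI\<close>)
  then have "f a = f b" if "b \<in> ball a e" for b
    using that e(1) by (metis centre_in_ball)
  then show "eventually (\<lambda>b. f a = f b) (at a within C)"
    unfolding eventually_at using e(1) by (auto simp: dist_commute)
qed

lemma scaled_triples_sum_eqD:
  fixes k p q c x y n p' q' m :: real
  assumes "k *\<^sub>R (p, q, 0) + c *\<^sub>R (x, y, n) = (p', q', m)"
  shows "c * n = m" "k * p + c * x = p'" "k * q + c * y = q'"
  using assms by auto

text \<open>The two charts may come with different choices of unit field, and their overlap may be
  disconnected. The curvature rules out opposite fields; translation, sign and constant are locally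
  constant, hence the connected \<open>W\<close>.\<close>

lemma normal_coords_unique:
  assumes A: "normal_chart r S E U X c1 c2" and B: "normal_chart r S E' U' X' c1' c2'"
    and W: "connected W" "W \<subseteq> X ` U \<inter> X' ` U'"
  shows "\<exists>t s d.
    (\<forall>u\<in>U. \<forall>u'\<in>U'. X u = X' u' \<and> X u \<in> W \<longrightarrow> snd u' = snd u + t) \<and>
    agree_up_to t s d (snd ` {u\<in>U. X u \<in> W}) c1 c2 (snd ` {u\<in>U'. X' u \<in> W}) c1' c2'"
proof -
  interpret A: normal_chart r S E U X c1 c2 by (rule A)
  interpret B: normal_chart r S E' U' X' c1' c2' by (rule B)
  obtain g where g: "homeomorphism U (X ` U) X g"
    using A.local_param unfolding local_param_def by blast
  obtain g' where g': "homeomorphism U' (X' ` U') X' g'"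
    using B.local_param unfolding local_param_def by blast
  define V where "V = {u \<in> U. X u \<in> X' ` U'}"
  \<comment> \<open>The change of coordinates on the overlap \<open>V\<close>.\<close>
  define \<Psi> where "\<Psi> = (\<lambda>u. g' (X u))"
  have contX: "continuous_on U X"
    by (rule smooth_on_imp_continuous_on[OF A.smooth_X])
  have VU: "u \<in> U" if "u \<in> V" for u
    using that by (simp add: V_def)
  have openV: "open V"
  proof -
    obtain T where T: "open T" "X' ` U' = S \<inter> T"
      using B.local_param unfolding local_param_def openin_open by blast
    then have "V = U \<inter> X -` T"
      using A.X_in by (auto simp: V_def)
    then show ?thesis
      using continuous_open_preimage[OF contX A.open_U T(1)] by simp
  qed
  have \<Psi>: "\<Psi> u \<in> U'" "X' (\<Psi> u) = X u" if "u \<in> V" for u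
    using g' that by (force simp: homeomorphism_def V_def \<Psi>_def)+
  have "\<forall>u. \<exists>k. u \<in> V \<longrightarrow> (\<Psi> has_derivative k) (at u) \<and>
      (\<forall>v. frechet_derivative X' (at (\<Psi> u)) (k v) = frechet_derivative X (at u) v)"
    using local_param_lift[OF B.local_param g' openV, of _ X] contX A.X_derivative
    unfolding \<Psi>_def by (metis (no_types, lifting) V_def continuous_on_subset image_subsetI mem_Collect_eq subsetI)
  then obtain K where K: "\<And>u. u \<in> V \<Longrightarrow> (\<Psi> has_derivative K u) (at u)"
    "\<And>u v. u \<in> V \<Longrightarrow> frechet_derivative X' (at (\<Psi> u)) (K u v) = frechet_derivative X (at u) v"
    by metis
  have Kc: "fst (K u v) *\<^sub>R (B.P (\<Psi> u), B.Q (\<Psi> u), 0) +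
      (snd (K u v) * sgn (B.D (\<Psi> u)) / (2 * r)) *\<^sub>R
      (B.D (\<Psi> u) * B.P (\<Psi> u) - sin (B.phase (\<Psi> u)) * B.Q (\<Psi> u),
       B.D (\<Psi> u) * B.Q (\<Psi> u) + sin (B.phase (\<Psi> u)) * B.P (\<Psi> u), B.D (\<Psi> u) / r) =
      frame_coords (X u) (frechet_derivative X (at u) v)" if "u \<in> V" for u v
    using B.frame_coords_X_derivative[OF \<Psi>(1)[OF that], of "K u v"]
    by (simp only: \<Psi>(2)[OF that] K(2)[OF that])
  \<comment> \<open>The inner product of the two unit fields. In terms of \<open>E'\<close> its
    continuity follows from the smoothness of \<open>E'\<close> along \<open>X\<close>.\<close>
  define \<mu> where "\<mu> u = A.P u * fst (E' (X u)) + A.Q u * fst (snd (E' (X u)))" for u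
  have E'X: "fst (E' (X u)) = B.P (\<Psi> u)" "fst (snd (E' (X u))) = B.Q (\<Psi> u)" if "u \<in> V" for u
    using B.E_X[OF \<Psi>(1)[OF that]] by (simp_all add: \<Psi>(2)[OF that] B.P_def B.Q_def)
  have along: "K u (1, 0) = (\<mu> u, 0) \<and> A.P u = \<mu> u * B.P (\<Psi> u) \<and> A.Q u = \<mu> u * B.Q (\<Psi> u) \<and> (\<mu> u)\<^sup>2 = 1"
    if u: "u \<in> V" for u
  proof -
    let ?k = "fst (K u (1, 0))"
    have "frame_coords (X u) (frechet_derivative X (at u) (1, 0)) = (A.P u, A.Q u, 0)"
      using A.frame_coords_Xx[OF VU[OF u]] by (simp add: A.Xx_def)
    note eq = scaled_triples_sum_eqD[OF Kc[OF u, of "(1, 0)", unfolded this]]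
    \<comment> \<open>\<open>Xx\<close> is horizontal, while the y derivative of the other chart has
      a nonzero Reeb coefficient.\<close>
    have snd0: "snd (K u (1, 0)) = 0"
      using eq(1) B.D_nonzero[OF \<Psi>(1)[OF u]] A.lam by (simp add: sgn_eq_0_iff)
    have PQ: "A.P u = ?k * B.P (\<Psi> u)" "A.Q u = ?k * B.Q (\<Psi> u)"
      using eq(2,3) snd0 by simp_all
    have "?k * ((B.P (\<Psi> u))\<^sup>2 + (B.Q (\<Psi> u))\<^sup>2) = \<mu> u"
      unfolding \<mu>_def E'X[OF u] PQ by (simp add: algebra_simps power2_eq_square)
    then have k: "?k = \<mu> u"
      using B.unit_Xx[OF \<Psi>(1)[OF u]] by simp
    have "(A.P u)\<^sup>2 + (A.Q u)\<^sup>2 = ?k\<^sup>2 * ((B.P (\<Psi> u))\<^sup>2 + (B.Q (\<Psi> u))\<^sup>2)"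
      unfolding PQ by (simp add: algebra_simps)
    then have "?k\<^sup>2 = 1"
      using B.unit_Xx[OF \<Psi>(1)[OF u]] A.unit_Xx[OF VU[OF u]] by simp
    then show ?thesis
      using PQ snd0 k by (simp add: prod_eq_iff)
  qed
  \<comment> \<open>If the fields were opposite at \<open>u\<close>, they would be so nearby by
    continuity. Following \<open>E'\<close> then means running backwards in x, where both fields
    turn at rate \<open>- 2 * r\<close>, whereas the curvature of \<open>E'\<close> demands
    \<open>2 * r\<close>.\<close>
  have \<mu>1: "\<mu> u = 1" if u: "u \<in> V" for u
  proof (rule ccontr)
    assume "\<mu> u \<noteq> 1"
    moreover have sq: "\<mu> w = 1 \<or> \<mu> w = -1" if "w \<in> V" for w
      using along[OF that] by (auto simp: power2_eq_1_iff)
    ultimately have \<mu>u: "\<mu> u = -1"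
      using u by blast
    have "smooth_on U (E' \<circ> X)"
      using B.cpmc A.local_param
      unfolding cpmc_surface_def nonsingular_surface_def smooth_field_along_def by blast
    then have "continuous_on U \<mu>"
      using smooth_on_imp_continuous_on[OF A.smooth_P] smooth_on_imp_continuous_on[OF A.smooth_Q]
      unfolding \<mu>_def[abs_def] by (auto intro!: continuous_intros dest!: smooth_on_imp_continuous_on simp: comp_def)
    then have "continuous_on V \<mu>"
      using VU by (metis continuous_on_subset subsetI)
    then have "open (V \<inter> \<mu> -` {..<0})"
      by (rule continuous_open_preimage[OF _ openV open_lessThan])
    then have op: "open ((\<lambda>t. u + t *\<^sub>R (-1, 0)) -` (V \<inter> \<mu> -` {..<0}))"
      by (intro continuous_open_vimage continuous_intros)
    have in_op: "0 \<in> (\<lambda>t. u + t *\<^sub>R (-1, 0)) -` (V \<inter> \<mu> -` {..<0})"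
      using u \<mu>u by (simp add: zero_prod_def[symmetric])
    let ?\<gamma> = "\<lambda>t. X (u + t *\<^sub>R (-1, 0))"
    have E'\<gamma>: "fst (E' (?\<gamma> t)) = - A.P (u + t *\<^sub>R (-1, 0))" "fst (snd (E' (?\<gamma> t))) = - A.Q (u + t *\<^sub>R (-1, 0))"
      if "t \<in> (\<lambda>t. u + t *\<^sub>R (-1, 0)) -` (V \<inter> \<mu> -` {..<0})" for t
    proof -
      let ?w = "u + t *\<^sub>R (-1, 0)"
      have w: "?w \<in> V" "\<mu> ?w = -1"
        using that sq[of ?w] by auto
      show "fst (E' (?\<gamma> t)) = - A.P ?w" "fst (snd (E' (?\<gamma> t))) = - A.Q ?w"
        using along[OF w(1)] unfolding E'X[OF w(1)] w(2) by simp_all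
    qed
    have "frechet_derivative X (at u) (-1, 0) = E' (X u)"
    proof (rule inj_frame_coords[of "X u"])
      show "frame_coords (X u) (frechet_derivative X (at u) (-1, 0)) = frame_coords (X u) (E' (X u))"
        using B.frame_coords_Xx[OF \<Psi>(1)[OF u]] B.E_X[OF \<Psi>(1)[OF u]] along[OF u]
        by (simp add: A.frame_coords_X_derivative[OF VU[OF u]] \<Psi>(2)[OF u] \<mu>u)
    qed
    with curve_in_local_param[OF A.local_param VU[OF u], of "(-1, 0)"]
    have "curve_in S (X u) (E' (X u)) ?\<gamma>" by simp
    moreover have "has_p_mean_curvature S E' (X u) (2 * r)"
      using B.cpmc A.X_in[OF VU[OF u]] by (simp add: cpmc_surface_def)
    ultimately have curv: "((\<lambda>t. fst (E' (?\<gamma> t))) has_real_derivative - (2 * r) * fst (snd (E' (X u)))) (at 0)"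
      "((\<lambda>t. fst (snd (E' (?\<gamma> t)))) has_real_derivative (2 * r) * fst (E' (X u))) (at 0)"
      using curvature_along_curve by blast+
    have E'u: "fst (E' (X u)) = - A.P u" "fst (snd (E' (X u))) = - A.Q u"
      using E'\<gamma>[OF in_op] by (simp_all add: zero_prod_def[symmetric])
    have "((\<lambda>t. - A.P (u + t *\<^sub>R (-1, 0))) has_real_derivative 2 * r * A.Q u) (at 0)"
      using has_field_derivative_transform_within_open[OF curv(1) op in_op E'\<gamma>(1)] E'u by simp
    moreover have "((\<lambda>t. - A.P (u + t *\<^sub>R (-1, 0))) has_vector_derivative - (- A.turning u (-1, 0) * A.Q u)) (at 0)"
      by (intro has_vector_derivative_minus has_derivative_along_line)
        (use A.P_derivative[OF VU[OF u]] in \<open>simp add: zero_prod_def[symmetric]\<close>)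
    ultimately have "2 * r * A.Q u = - (- A.turning u (-1, 0) * A.Q u)"
      unfolding has_real_derivative_iff_has_vector_derivative by (rule vector_derivative_unique_at)
    then have "A.Q u = 0"
      using A.lam by (simp add: A.turning_def)
    have "((\<lambda>t. - A.Q (u + t *\<^sub>R (-1, 0))) has_real_derivative - 2 * r * A.P u) (at 0)"
      using has_field_derivative_transform_within_open[OF curv(2) op in_op E'\<gamma>(2)] E'u by simp
    moreover have "((\<lambda>t. - A.Q (u + t *\<^sub>R (-1, 0))) has_vector_derivative - (A.turning u (-1, 0) * A.P u)) (at 0)"
      by (intro has_vector_derivative_minus has_derivative_along_line)
        (use A.Q_derivative[OF VU[OF u]] in \<open>simp add: zero_prod_def[symmetric]\<close>)
    ultimately have "- 2 * r * A.P u = - (A.turning u (-1, 0) * A.P u)"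
      unfolding has_real_derivative_iff_has_vector_derivative by (rule vector_derivative_unique_at)
    then have "A.P u = 0"
      using A.lam by (simp add: A.turning_def)
    with \<open>A.Q u = 0\<close> show False
      using A.unit_Xx[OF VU[OF u]] by simp
  qed
  have PQ: "B.P (\<Psi> u) = A.P u" "B.Q (\<Psi> u) = A.Q u" and Kx: "K u (1, 0) = (1, 0)" if "u \<in> V" for u
    using along[OF that] \<mu>1[OF that] by simp_all
  have EE': "E' (X u) = E (X u)" if u: "u \<in> V" for u
    by (rule inj_frame_coords[of "X u"])
      (use A.frame_coords_Xx[OF VU[OF u]] B.frame_coords_Xx[OF \<Psi>(1)[OF u]] PQ[OF u]
        A.E_X[OF VU[OF u]] B.E_X[OF \<Psi>(1)[OF u]] in \<open>simp add: \<Psi>(2)[OF u]\<close>)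
  have \<alpha>: "alpha S E' (X u) = alpha S E (X u)" if "u \<in> V" for u
    by (simp add: alpha_def EE'[OF that])
  \<comment> \<open>Since \<open>E\<close> and \<open>alpha\<close> agree, both charts have the same
    \<open>N\<close>. The Reeb coefficient gives the second equation, which makes the y parts equal
    and leaves no component along \<open>Xx\<close>.\<close>
  have Ky: "fst (K u (0, 1)) = 0" "snd (K u (0, 1)) * \<bar>B.D (\<Psi> u)\<bar> = \<bar>A.D u\<bar>" if u: "u \<in> V" for u
  proof -
    let ?k = "fst (K u (0, 1))" and ?m = "snd (K u (0, 1))"
    have 1: "?m * \<bar>B.D (\<Psi> u)\<bar> = \<bar>A.D u\<bar>"
    proof -
      have "?m * sgn (B.D (\<Psi> u)) / (2 * r) * (B.D (\<Psi> u) / r) = sgn (A.D u) / (2 * r) * (A.D u / r)"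
        using scaled_triples_sum_eqD(1)[OF Kc[OF u, of "(0, 1)", unfolded A.frame_coords_Xy[OF VU[OF u], unfolded A.Xy_def scaleR_Pair]]]
        by simp
      then show ?thesis
        using A.lam by (simp add: abs_sgn mult_ac)
    qed
    have "A.N u = B.N (\<Psi> u)"
      by (simp add: A.N_def B.N_def \<Psi>(2)[OF u] EE'[OF u] \<alpha>[OF u])
    moreover have "?k *\<^sub>R B.Xx (\<Psi> u) + ?m *\<^sub>R B.Xy (\<Psi> u) = A.Xy u"
      using K(2)[OF u, of "(0, 1)"] by (simp add: B.X_derivative_eq[OF \<Psi>(1)[OF u]] A.Xy_def)
    moreover have "?m *\<^sub>R B.Xy (\<Psi> u) = ((?m * \<bar>B.D (\<Psi> u)\<bar>) / (2 * r\<^sup>2)) *\<^sub>R B.N (\<Psi> u)"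
      by (simp add: B.Xy_eq[OF \<Psi>(1)[OF u]])
    ultimately have "?k *\<^sub>R B.Xx (\<Psi> u) = 0"
      by (simp add: 1 A.Xy_eq[OF VU[OF u]])
    moreover have "B.Xx (\<Psi> u) \<noteq> 0"
      using B.unit_Xx[OF \<Psi>(1)[OF u]] by (auto simp: B.P_def B.Q_def)
    ultimately show "?k = 0" by simp
    show "?m * \<bar>B.D (\<Psi> u)\<bar> = \<bar>A.D u\<bar>" by (rule 1)
  qed
  have d\<phi>: "((\<lambda>u. B.phase (\<Psi> u)) has_derivative (\<lambda>v. 2 * r * fst (K u v) + B.dc1 (\<Psi> u) (snd (K u v)))) (at u)"
    if u: "u \<in> V" for u
    using has_derivative_compose[OF K(1)[OF u] B.phase_derivative[OF \<Psi>(1)[OF u]]] .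
  have dD: "((\<lambda>u. B.D (\<Psi> u)) has_derivative (\<lambda>v. B.dc2 (\<Psi> u) (snd (K u v)) +
      sin (B.phase (\<Psi> u)) * (2 * r * fst (K u v) + B.dc1 (\<Psi> u) (snd (K u v))))) (at u)"
    if u: "u \<in> V" for u
    using has_derivative_compose[OF K(1)[OF u] B.D_derivative[OF \<Psi>(1)[OF u]]] .
  have sinD: "sin (A.phase u) * B.D (\<Psi> u) = sin (B.phase (\<Psi> u)) * A.D u" if u: "u \<in> V" for u
  proof -
    have "alpha S E (X u) * A.D u = r * sin (A.phase u)"
      using A.alpha_eq[OF VU[OF u]] A.D_nonzero[OF VU[OF u]] by simp
    moreover have "alpha S E (X u) * B.D (\<Psi> u) = r * sin (B.phase (\<Psi> u))"
      using B.alpha_eq[OF \<Psi>(1)[OF u]] B.D_nonzero[OF \<Psi>(1)[OF u]] by (simp add: \<alpha>[OF u] \<Psi>(2)[OF u])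
    ultimately have "r * (sin (A.phase u) * B.D (\<Psi> u)) = r * (sin (B.phase (\<Psi> u)) * A.D u)"
      by algebra
    then show ?thesis
      using A.lam by simp
  qed
  \<comment> \<open>The derivative of \<open>sinD\<close> in direction (1, 0): both phases grow at
    rate \<open>2 * r\<close>, and the products of two sines cancel.\<close>
  have cosD: "cos (A.phase u) * B.D (\<Psi> u) = cos (B.phase (\<Psi> u)) * A.D u" if u: "u \<in> V" for u
  proof -
    have "((\<lambda>w. sin (A.phase w) * B.D (\<Psi> w) - sin (B.phase (\<Psi> w)) * A.D w) has_derivative
      (\<lambda>v. sin (A.phase u) * (B.dc2 (\<Psi> u) (snd (K u v)) +
             sin (B.phase (\<Psi> u)) * (2 * r * fst (K u v) + B.dc1 (\<Psi> u) (snd (K u v))))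
         + cos (A.phase u) * (2 * r * fst v + A.dc1 u (snd v)) * B.D (\<Psi> u)
         - (sin (B.phase (\<Psi> u)) * (A.dc2 u (snd v) + sin (A.phase u) * (2 * r * fst v + A.dc1 u (snd v)))
         + cos (B.phase (\<Psi> u)) * (2 * r * fst (K u v) + B.dc1 (\<Psi> u) (snd (K u v))) * A.D u))) (at u)"
      by (auto intro!: derivative_eq_intros d\<phi> dD A.phase_derivative A.D_derivative VU u)
    moreover have "((\<lambda>w. sin (A.phase w) * B.D (\<Psi> w) - sin (B.phase (\<Psi> w)) * A.D w) has_derivative (\<lambda>v. 0)) (at u)"
      by (rule has_derivative_transform_within_open[OF has_derivative_const openV u]) (simp add: sinD)
    ultimately have "(\<lambda>v. sin (A.phase u) * (B.dc2 (\<Psi> u) (snd (K u v)) +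
             sin (B.phase (\<Psi> u)) * (2 * r * fst (K u v) + B.dc1 (\<Psi> u) (snd (K u v))))
         + cos (A.phase u) * (2 * r * fst v + A.dc1 u (snd v)) * B.D (\<Psi> u)
         - (sin (B.phase (\<Psi> u)) * (A.dc2 u (snd v) + sin (A.phase u) * (2 * r * fst v + A.dc1 u (snd v)))
         + cos (B.phase (\<Psi> u)) * (2 * r * fst (K u v) + B.dc1 (\<Psi> u) (snd (K u v))) * A.D u)) = (\<lambda>v. 0)"
      by (rule has_derivative_unique)
    from fun_cong[OF this, of "(1, 0)"]
    have "2 * r * (cos (A.phase u) * B.D (\<Psi> u) - cos (B.phase (\<Psi> u)) * A.D u) = 0"
      by (simp add: Kx[OF u] A.dc_zero[OF VU[OF u]] B.dc_zero[OF \<Psi>(1)[OF u]] algebra_simps)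
    then show ?thesis
      using A.lam by simp
  qed
  \<comment> \<open>\<open>sinD\<close> and \<open>cosD\<close> say that \<open>A.D u\<close> times
    the unit vector at the second phase is \<open>B.D (\<Psi> u)\<close> times the one at the first.
    So the phases differ by a multiple of pi, and \<open>cos (q u)\<close> is the sign relating the
    denominators.\<close>
  define q where "q u = B.phase (\<Psi> u) - A.phase u" for u
  have q: "sin (q u) = 0" "(cos (q u))\<^sup>2 = 1" "B.D (\<Psi> u) = cos (q u) * A.D u"
    "cos (B.phase (\<Psi> u)) = cos (q u) * cos (A.phase u)" if u: "u \<in> V" for u
  proof -
    have nz: "A.D u \<noteq> 0"
      using A.D_nonzero VU u by blast
    have "A.D u * sin (q u) = 0"
      unfolding q_def sin_diff using sinD[OF u] cosD[OF u] by algebra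
    then show s: "sin (q u) = 0"
      using nz by simp
    then show "(cos (q u))\<^sup>2 = 1"
      using sin_cos_squared_add[of "q u"] by simp
    show "cos (B.phase (\<Psi> u)) = cos (q u) * cos (A.phase u)"
      using cos_add[of "q u" "A.phase u"] s by (simp add: q_def)
    have "cos (q u) * A.D u = B.D (\<Psi> u) * ((cos (A.phase u))\<^sup>2 + (sin (A.phase u))\<^sup>2)"
      unfolding q_def cos_diff using sinD[OF u] cosD[OF u] by algebra
    then show "B.D (\<Psi> u) = cos (q u) * A.D u" by simp
  qed
  have c2: "c2' (snd (\<Psi> u)) = cos (q u) * c2 (snd u)" if u: "u \<in> V" for u
    using q(3,4)[OF u] by (simp add: A.D_def B.D_def algebra_simps)
  \<comment> \<open>In y the stretch is the quotient of the absolute values of the two denominators,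
    now known to be 1.\<close>
  have K_id: "K u v = v" if u: "u \<in> V" for u v
  proof -
    have "\<bar>cos (q u)\<bar> = 1"
      using q(2)[OF u] by (simp add: power2_eq_1_iff) argo
    then have "snd (K u (0, 1)) = 1"
      using Ky(2)[OF u] A.D_nonzero[OF VU[OF u]] by (simp add: q(3)[OF u] abs_mult)
    then show ?thesis
      using linear_prod2[OF has_derivative_linear[OF K(1)[OF u]], of v] Kx[OF u] Ky(1)[OF u]
      by (simp add: prod_eq_iff)
  qed
  have d\<Psi>: "((\<lambda>u. \<Psi> u - u) has_derivative (\<lambda>v. 0)) (at u)" if u: "u \<in> V" for u
    using has_derivative_diff[OF K(1)[OF u] has_derivative_ident] by (simp add: K_id[OF u])
  \<comment> \<open>\<open>sin (q u)\<close> vanishes on the open set \<open>V\<close>;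
    differentiating it leaves the factor \<open>cos (q u)\<close>, which is 1 or -1.\<close>
  have dq: "(q has_derivative (\<lambda>v. 0)) (at u)" if u: "u \<in> V" for u
  proof -
    obtain q' where q': "(q has_derivative q') (at u)"
      unfolding q_def using has_derivative_diff[OF d\<phi>[OF u] A.phase_derivative[OF VU[OF u]]] by blast
    have "((\<lambda>w. sin (q w)) has_derivative (\<lambda>v. cos (q u) * q' v)) (at u)"
      by (auto intro!: derivative_eq_intros q')
    moreover have "((\<lambda>w. sin (q w)) has_derivative (\<lambda>v. 0)) (at u)"
      by (rule has_derivative_transform_within_open[OF has_derivative_const openV u]) (simp add: q)
    ultimately have "(\<lambda>v. cos (q u) * q' v) = (\<lambda>v. 0)"
      by (rule has_derivative_unique)
    moreover have "cos (q u) \<noteq> 0"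
      using q(2)[OF u] by auto
    ultimately have "q' = (\<lambda>v. 0)"
      by (simp add: fun_eq_iff)
    with q' show ?thesis by simp
  qed
  define C where "C = {u \<in> U. X u \<in> W}"
  have CV: "C \<subseteq> V"
    using W(2) by (auto simp: C_def V_def)
  \<comment> \<open>The chart identifies \<open>C\<close> with \<open>W\<close> homeomorphically, so
    \<open>C\<close> inherits connectedness.\<close>
  have "C = g ` W"
  proof (intro set_eqI iffI)
    fix u assume "u \<in> C"
    then show "u \<in> g ` W"
      using homeomorphism_apply1[OF g] by (intro image_eqI[of _ _ "X u"]) (auto simp: C_def)
  next
    fix u assume "u \<in> g ` W"
    then obtain v where "v \<in> U" "X v \<in> W" "u = g (X v)"
      using W(2) by blast
    then show "u \<in> C"
      using homeomorphism_apply1[OF g] by (simp add: C_def)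
  qed
  moreover have "connected (g ` W)"
    by (rule connected_continuous_image[OF continuous_on_subset[OF homeomorphism_cont2[OF g]] W(1)])
      (use W(2) in blast)
  ultimately have "connected C" by simp
  note const = constant_on_connected_subset[OF openV CV this]
  have \<Psi>_unique: "u' = \<Psi> u" if "u' \<in> U'" "X u = X' u'" for u u'
    using that g' by (simp add: \<Psi>_def homeomorphism_def)
  show ?thesis
  proof (cases "C = {}")
    case True
    then show ?thesis
      unfolding C_def by (intro exI[of _ 0] exI[of _ 1]) (auto simp: agree_up_to_def)
  next
    case False
    then obtain u0 where u0: "u0 \<in> C" by blast
    define t where "t = snd (\<Psi> u0 - u0)"
    define s where "s = cos (q u0)"
    \<comment> \<open>The phase difference is the change of \<open>c1\<close> plus
      \<open>2 * r\<close> times the translation in x; removing the latter leaves the constant for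
      \<open>c1\<close>.\<close>
    define d where "d = q u0 - 2 * r * fst (\<Psi> u0 - u0)"
    have shift: "\<Psi> u - u = \<Psi> u0 - u0" "q u = q u0" if "u \<in> C" for u
      using const[OF that u0, of "\<lambda>u. \<Psi> u - u"] const[OF that u0, of q] d\<Psi> dq by blast+
    have snd_\<Psi>: "snd (\<Psi> u) = snd u + t" if "u \<in> C" for u
      using shift(1)[OF that] by (simp add: t_def prod_eq_iff)
    have c: "c2' (snd u + t) = s * c2 (snd u)" "c1' (snd u + t) = c1 (snd u) + d" if u: "u \<in> C" for u
    proof -
      have "u \<in> V" using u CV by blast
      from c2[OF this] show "c2' (snd u + t) = s * c2 (snd u)"
        by (simp add: snd_\<Psi>[OF u] s_def shift(2)[OF u])
      have "fst (\<Psi> u) = fst u + (fst (\<Psi> u0) - fst u0)"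
        using shift(1)[OF u] by (simp add: prod_eq_iff)
      note fst_\<Psi> = this
      show "c1' (snd u + t) = c1 (snd u) + d"
        using shift(2)[OF u] unfolding d_def q_def[of u] A.phase_def B.phase_def snd_\<Psi>[OF u] fst_\<Psi>
        by (simp add: algebra_simps)
    qed
    have "s \<in> {1, -1}"
      using q(2)[of u0] u0 CV by (auto simp: s_def power2_eq_1_iff)
    then have "agree_up_to t s d (snd ` C) c1 c2 (snd ` {u\<in>U'. X' u \<in> W}) c1' c2'"
      unfolding agree_up_to_def using c by blast
    moreover have "snd u' = snd u + t" if "u \<in> U" "u' \<in> U'" "X u = X' u'" "X u \<in> W" for u u'
      using \<Psi>_unique[OF that(2,3)] snd_\<Psi>[of u] that by (simp add: C_def)
    ultimately show ?thesis
      unfolding C_def by blast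
  qed
qed

theorem theorem6p3:
  fixes l :: real
  assumes "l > 0"
  shows
    \<comment> \<open>uniqueness of c1 and c2, on each connected part of the overlap of two normal coordinate systems\<close>
    "(\<forall>S E E' U X c1 c2 U' X' c1' c2' W.
        cpmc_surface l S E \<and> normal_coords l S E U X c1 c2 \<and>
        cpmc_surface l S E' \<and> normal_coords l S E' U' X' c1' c2' \<and>
        connected W \<and> W \<subseteq> X ` U \<inter> X' ` U' \<longrightarrow>
        (\<exists>t s d.
           (\<forall>u\<in>U. \<forall>u'\<in>U'. X u = X' u' \<and> X u \<in> W \<longrightarrow> snd u' = snd u + t) \<and>
           agree_up_to t s d (snd ` {u\<in>U. X u \<in> W}) c1 c2 (snd ` {u\<in>U'. X' u \<in> W}) c1' c2')) \<and>
     (\<forall>F S E U X c1 c2.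
        heis_rigid_motion F \<and> cpmc_surface l S E \<and> normal_coords l S E U X c1 c2 \<longrightarrow>
        cpmc_surface l (F ` S) (push_forward F E) \<and>
        normal_coords l (F ` S) (push_forward F E) U (F \<circ> X) c1 c2) \<and>
     (\<forall>S E U X c1 c2 S' E' U' X' c1' c2' t s d.
        cpmc_surface l S E \<and> normal_coords l S E U X c1 c2 \<and>
        cpmc_surface l S' E' \<and> normal_coords l S' E' U' X' c1' c2' \<and>
        agree_up_to t s d (snd ` U) c1 c2 (snd ` U') c1' c2' \<longrightarrow>
        (\<forall>u\<in>U. \<forall>u'\<in>U'. snd u' = snd u + t \<and> phases_match l s c1 c1' u u' \<longrightarrow>
           locally_congruent_at S (X u) S' (X' u')))"
proof -
  have chart: "normal_chart l S E U X c1 c2"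
    if "cpmc_surface l S E" "normal_coords l S E U X c1 c2" for S E U X c1 c2
    using that assms by unfold_locales
  show ?thesis
  proof (intro conjI allI impI ballI; (elim conjE)?)
    fix S E E' U X c1 c2 U' X' c1' c2' W
    assume "cpmc_surface l S E" "normal_coords l S E U X c1 c2"
      "cpmc_surface l S E'" "normal_coords l S E' U' X' c1' c2'"
      "connected W" "W \<subseteq> X ` U \<inter> X' ` U'"
    from normal_coords_unique[OF chart[OF this(1,2)] chart[OF this(3,4)] this(5,6)]
    show "\<exists>t s d.
           (\<forall>u\<in>U. \<forall>u'\<in>U'. X u = X' u' \<and> X u \<in> W \<longrightarrow> snd u' = snd u + t) \<and>
           agree_up_to t s d (snd ` {u\<in>U. X u \<in> W}) c1 c2 (snd ` {u\<in>U'. X' u \<in> W}) c1' c2'" .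
  next
    fix F S E U X c1 c2
    assume "heis_rigid_motion F" "cpmc_surface l S E" "normal_coords l S E U X c1 c2"
    then show "cpmc_surface l (F ` S) (push_forward F E)"
      "normal_coords l (F ` S) (push_forward F E) U (F \<circ> X) c1 c2"
      by (rule rigid_motion_invariance)+
  next
    fix S E U X c1 c2 S' E' U' X' c1' c2' t s d u u'
    assume "cpmc_surface l S E" "normal_coords l S E U X c1 c2"
      "cpmc_surface l S' E'" "normal_coords l S' E' U' X' c1' c2'"
      "agree_up_to t s d (snd ` U) c1 c2 (snd ` U') c1' c2'"
      "u \<in> U" "u' \<in> U'" "snd u' = snd u + t" "phases_match l s c1 c1' u u'"
    from normal_charts_locally_congruent[OF chart[OF this(1,2)] chart[OF this(3,4)] this(5-9)]
    show "locally_congruent_at S (X u) S' (X' u')" .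
  qed
qed

end
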